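(* Let $n_1\geq1$. The kernel of the null periodic X-ray transform on a conformal Minkowski torus of signature $(n_1,1)$ is precisely the set of functions whose Fourier series is supported outside the set $$K=\{(k,t)\in\mathbb{Z}^{n_1}\times\mathbb{Z} : \exists (v,s)\in\mathbb{Z}^{n_1}\times\mathbb{Z}\text{ such that }|v|^2=s^2\neq0,\ v\cdot k+st=0\}.$$ We always have $$\{(k,t)\in\mathbb{Z}^{n_1}\times\mathbb{Z} : |t|=|k|\}\subset K\subset\{(k,t)\in\mathbb{Z}^{n_1}\times\mathbb{Z} : |t|\leq|k|\}.$$ For $n_1=1$ we have $$K=\{(k,t)\in\mathbb{Z}\times\mathbb{Z} : |t|=|k|\},$$ for $n_1=2$ $$K=\{(k,t)\in\mathbb{Z}^2\times\mathbb{Z} : \sqrt{|k|^2-|t|^2}\in\mathbb{N}\},$$ and for $n_1=3$ $$K=\{(k,t)\in\mathbb{Z}^3\times\mathbb{Z} : |k|^2-|t|^2\text{ is a sum of two integer squares}\}.$$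
   Context: The Minkowski space $\mathbb{R}^{n_1,1}$ is $\mathbb{R}^{n_1+1}$ with the pseudo-Riemannian metric $\mathrm{d}x_1^2+\cdots+\mathrm{d}x_{n_1}^2-\mathrm{d}x_{n_1+1}^2$. The Minkowski torus of signature $(n_1,1)$ is $\mathbb{T}^{n_1,1}=\mathbb{R}^{n_1,1}/\mathbb{Z}^{n_1+1}$ with the induced metric $g$, and a conformal Minkowski torus is the same torus with the metric $cg$, where $c$ is a smooth positive function. A null geodesic is a geodesic whose tangent vectors have zero square in the metric. The null periodic X-ray transform on a conformal Minkowski torus takes a function on the torus to its integrals over all periodic (closed) null geodesics of the metric $cg$; only closed null geodesics are included. Its kernel is the set of functions for which all these integrals vanish. As unparametrized curves the null geodesics of $cg$ and $g$ coincide; the conformal change only reparametrizes them, and knowing the integrals of $f$ over null geodesics of $cg$ is taken to be equivalent to knowing the integrals of $\sqrt{c}f$ with respect to $g$. For the standard metric $g$ the integrals of $f$ are $R_wf(x)=\int_0^1f(x+\tau w)\,\mathrm{d}\tau$ for all $w=(v,s)\in\mathbb{Z}^{n_1}\times\mathbb{Z}$ with $|v|^2=s^2\neq0$. No particular regularity class of functions is fixed; distributions are also allowed, with $R_wf$ defined by duality, $\langle R_wf,\phi\rangle=\langle f,R_w\phi\rangle$ for smooth $\phi$. The Fourier series of $f$ is supported outside $K$ if the Fourier coefficients $\hat f(k,t)$ of $f$ with respect to the functions $x\mapsto e^{2\pi i(k,t)\cdot x}$ vanish for all $(k,t)\in K$. The norm $|\cdot|$ and the dot product are Euclidean, $\mathbb{N}$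 includes $0$, and the squares in a sum of two integer squares may be zero.
   Formalization: For the metric cg the kernel is described as the functions (or distributions) f for which the Fourier series of √c·f, rather than of f itself, is supported outside K; the claim for f itself holds only for constant c. *)

theory Defs
  imports "HOL-Analysis.Analysis"
begin

text \<open>
  Points and tangent vectors of the Minkowski space with \<open>n\<^sub>1\<close> = \<open>CARD('n)\<close> space dimensions are
  pairs (space, time) of type \<open>(real^'n) \<times> real\<close>. Integer vectors have type \<open>(int^'n) \<times> int\<close>.
  The torus is handled on its universal cover: functions on it are \<open>\<int>\<close>-periodic functions.
\<close>

definition rvec :: "int^'n \<Rightarrow> real^'n" where
  "rvec v = (\<chi> i. real_of_int (v $ i))"

definition lattice_vec :: "(int^'n) \<times> int \<Rightarrow> (real^'n) \<times> real" where
  "lattice_vec w = (rvec (fst w), real_of_int (snd w))"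

definition periodic_fun :: "((real^'n) \<times> real \<Rightarrow> 'b) \<Rightarrow> bool" where
  "periodic_fun f \<longleftrightarrow> (\<forall>x w. f (x + lattice_vec w) = f x)"

primrec iter_partial ::
  "'a::euclidean_space list \<Rightarrow> ('a \<Rightarrow> 'b::real_normed_vector) \<Rightarrow> 'a \<Rightarrow> 'b" where
  "iter_partial [] f = f"
| "iter_partial (b # bs) f = (\<lambda>x. frechet_derivative (iter_partial bs f) (at x) b)"

text \<open>
  Differentiability of all iterated partial derivatives implies their continuity, so this
  is \<open>C\<^sup>\<infinity>\<close>.
\<close>

definition smooth_fun :: "('a::euclidean_space \<Rightarrow> 'b::real_normed_vector) \<Rightarrow> bool" where
  "smooth_fun f \<longleftrightarrow> (\<forall>bs \<in> lists Basis. iter_partial bs f differentiable_on UNIV)"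

definition torus_smooth :: "((real^'n) \<times> real \<Rightarrow> 'b::real_normed_vector) \<Rightarrow> bool" where
  "torus_smooth f \<longleftrightarrow> periodic_fun f \<and> smooth_fun f"

definition torus_continuous :: "((real^'n) \<times> real \<Rightarrow> 'b::real_normed_vector) \<Rightarrow> bool" where
  "torus_continuous f \<longleftrightarrow> periodic_fun f \<and> continuous_on UNIV f"


section \<open>Metrics, geodesics and closed null geodesics\<close>

text \<open>A metric maps a point and two tangent vectors to a real number.\<close>

type_synonym 'a metric_tensor = "'a \<Rightarrow> 'a \<Rightarrow> 'a \<Rightarrow> real"

definition minkowski :: "((real^'n) \<times> real) metric_tensor" where
  "minkowski x u v = fst u \<bullet> fst v - snd u * snd v"

definition conformal_minkowski ::
  "((real^'n) \<times> real \<Rightarrow> real) \<Rightarrow> ((real^'n) \<times> real) metric_tensor" where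
  "conformal_minkowski c x u v = c x * minkowski x u v"

text \<open>
  Christoffel symbol of the first kind \<open>\<Gamma>\<^bsub>u,ab\<^esub>\<close>, extended linearly to arbitrary directions.
  Since a metric is nondegenerate, \<open>G(\<gamma>'', u) + \<Gamma>\<^bsub>u,\<gamma>'\<gamma>'\<^esub> = 0\<close> for all \<open>u\<close> is the usual
  geodesic equation with the index lowered.
\<close>

definition christoffel_first ::
  "'a::real_normed_vector metric_tensor \<Rightarrow> 'a \<Rightarrow> 'a \<Rightarrow> 'a \<Rightarrow> 'a \<Rightarrow> real" where
  "christoffel_first G x a b u =
     (frechet_derivative (\<lambda>y. G y b u) (at x) a
      + frechet_derivative (\<lambda>y. G y a u) (at x) b
      - frechet_derivative (\<lambda>y. G y a b) (at x) u) / 2"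

definition geodesic :: "'a::real_normed_vector metric_tensor \<Rightarrow> (real \<Rightarrow> 'a) \<Rightarrow> bool" where
  "geodesic G \<gamma> \<longleftrightarrow>
     (\<exists>\<gamma>' \<gamma>''. \<forall>\<tau>. (\<gamma> has_vector_derivative \<gamma>' \<tau>) (at \<tau>)
        \<and> (\<gamma>' has_vector_derivative \<gamma>'' \<tau>) (at \<tau>)
        \<and> (\<forall>u. G (\<gamma> \<tau>) (\<gamma>'' \<tau>) u + christoffel_first G (\<gamma> \<tau>) (\<gamma>' \<tau>) (\<gamma>' \<tau>) u = 0))"

text \<open>Constant curves are excluded from the null geodesics.\<close>

definition null_geodesic :: "'a::real_normed_vector metric_tensor \<Rightarrow> (real \<Rightarrow> 'a) \<Rightarrow> bool" where
  "null_geodesic G \<gamma> \<longleftrightarrow> geodesic G \<gamma>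
     \<and> (\<forall>\<tau>. vector_derivative \<gamma> (at \<tau>) \<noteq> 0
          \<and> G (\<gamma> \<tau>) (vector_derivative \<gamma> (at \<tau>)) (vector_derivative \<gamma> (at \<tau>)) = 0)"

text \<open>
  \<open>\<gamma>\<close> is a lift of a curve on the torus; \<open>T\<close> is any positive period of that curve, not
  necessarily the least one.
\<close>

definition closed_null_geodesic ::
  "((real^'n) \<times> real) metric_tensor \<Rightarrow> (real \<Rightarrow> (real^'n) \<times> real) \<Rightarrow> real \<Rightarrow> bool" where
  "closed_null_geodesic G \<gamma> T \<longleftrightarrow>
     null_geodesic G \<gamma> \<and> T > 0 \<and> (\<forall>\<tau>. \<exists>w. \<gamma> (\<tau> + T) = \<gamma> \<tau> + lattice_vec w)"


section \<open>The null periodic X-ray transform\<close>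

text \<open>
  The integral of \<open>f\<close> over a closed null geodesic \<open>\<sigma>\<close> of the metric \<open>c g\<close> with period \<open>S\<close> is, by
  convention, the integral of \<open>\<surd>c f\<close> over the same curve as a geodesic \<open>\<gamma>\<close> of \<open>g\<close>, normalized to
  have period 1. This determines the value: \<open>\<gamma>\<close> is unique up to a translation of the parameter.
\<close>

definition has_null_integral ::
  "((real^'n) \<times> real \<Rightarrow> real) \<Rightarrow> ((real^'n) \<times> real \<Rightarrow> complex) \<Rightarrow>
   (real \<Rightarrow> (real^'n) \<times> real) \<Rightarrow> real \<Rightarrow> complex \<Rightarrow> bool" where
  "has_null_integral c f \<sigma> S I \<longleftrightarrow>
     (\<exists>\<gamma> h. closed_null_geodesic minkowski \<gamma> 1
        \<and> strict_mono h \<and> surj h \<and> (\<forall>\<tau>. h (\<tau> + 1) = h \<tau> + S) \<and> \<gamma> = \<sigma> \<circ> h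
        \<and> ((\<lambda>\<tau>. of_real (sqrt (c (\<gamma> \<tau>))) * f (\<gamma> \<tau>)) has_integral I) {0..1})"

definition null_xray_kernel ::
  "((real^'n) \<times> real \<Rightarrow> real) \<Rightarrow> ((real^'n) \<times> real \<Rightarrow> complex) set" where
  "null_xray_kernel c =
     {f. torus_continuous f \<and>
         (\<forall>\<sigma> S I. closed_null_geodesic (conformal_minkowski c) \<sigma> S
            \<longrightarrow> has_null_integral c f \<sigma> S I \<longrightarrow> I = 0)}"


section \<open>Distributions on the torus\<close>

text \<open>
  Only the values of \<open>u\<close> on smooth periodic functions matter. The norm estimate is continuity with
  respect to the seminorms of \<open>C\<^sup>\<infinity>\<close>.
\<close>

definition torus_distribution :: "(((real^'n) \<times> real \<Rightarrow> complex) \<Rightarrow> complex) \<Rightarrow> bool" where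
  "torus_distribution u \<longleftrightarrow>
     (\<forall>\<phi> \<psi>. torus_smooth \<phi> \<longrightarrow> torus_smooth \<psi> \<longrightarrow> u (\<lambda>x. \<phi> x + \<psi> x) = u \<phi> + u \<psi>)
     \<and> (\<forall>a \<phi>. torus_smooth \<phi> \<longrightarrow> u (\<lambda>x. a * \<phi> x) = a * u \<phi>)
     \<and> (\<exists>C m. \<forall>\<phi> B. torus_smooth \<phi>
          \<longrightarrow> (\<forall>bs \<in> lists Basis. length bs \<le> m \<longrightarrow> (\<forall>x. norm (iter_partial bs \<phi> x) \<le> B))
          \<longrightarrow> norm (u \<phi>) \<le> C * B)"

definition mult_distribution ::
  "((real^'n) \<times> real \<Rightarrow> real) \<Rightarrow> (((real^'n) \<times> real \<Rightarrow> complex) \<Rightarrow> complex) \<Rightarrow>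
   ((real^'n) \<times> real \<Rightarrow> complex) \<Rightarrow> complex" where
  "mult_distribution a u \<phi> = u (\<lambda>x. of_real (a x) * \<phi> x)"

definition null_lattice :: "((int^'n) \<times> int) set" where
  "null_lattice = {(v, s). (norm (rvec v))\<^sup>2 = (real_of_int s)\<^sup>2 \<and> (real_of_int s)\<^sup>2 \<noteq> 0}"

definition line_transform ::
  "(int^'n) \<times> int \<Rightarrow> ((real^'n) \<times> real \<Rightarrow> complex) \<Rightarrow> (real^'n) \<times> real \<Rightarrow> complex" where
  "line_transform w f x = integral {0..1} (\<lambda>\<tau>. f (x + \<tau> *\<^sub>R lattice_vec w))"

definition line_transform_distr ::
  "(int^'n) \<times> int \<Rightarrow> (((real^'n) \<times> real \<Rightarrow> complex) \<Rightarrow> complex) \<Rightarrow>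
   ((real^'n) \<times> real \<Rightarrow> complex) \<Rightarrow> complex" where
  "line_transform_distr w u \<phi> = u (line_transform w \<phi>)"

definition null_xray_kernel_distr ::
  "((real^'n) \<times> real \<Rightarrow> real) \<Rightarrow> (((real^'n) \<times> real \<Rightarrow> complex) \<Rightarrow> complex) set" where
  "null_xray_kernel_distr c =
     {u. torus_distribution u \<and>
         (\<forall>w \<in> null_lattice. \<forall>\<phi>. torus_smooth \<phi> \<longrightarrow>
            line_transform_distr w (mult_distribution (\<lambda>x. sqrt (c x)) u) \<phi> = 0)}"


section \<open>Fourier coefficients\<close>

definition torus_character :: "(int^'n) \<times> int \<Rightarrow> (real^'n) \<times> real \<Rightarrow> complex" where
  "torus_character \<kappa> x = exp (2 * of_real pi * \<i> * of_real (lattice_vec \<kappa> \<bullet> x))"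

text \<open>\<open>cbox 0 One\<close> is the unit cube. The dual pairing is bilinear, whence the conjugation below.\<close>

definition fourier_coeff ::
  "((real^'n) \<times> real \<Rightarrow> complex) \<Rightarrow> (int^'n) \<times> int \<Rightarrow> complex" where
  "fourier_coeff f \<kappa> = integral (cbox 0 One) (\<lambda>x. f x * cnj (torus_character \<kappa> x))"

definition fourier_coeff_distr ::
  "(((real^'n) \<times> real \<Rightarrow> complex) \<Rightarrow> complex) \<Rightarrow> (int^'n) \<times> int \<Rightarrow> complex" where
  "fourier_coeff_distr u \<kappa> = u (\<lambda>x. cnj (torus_character \<kappa> x))"

definition null_frequencies :: "((int^'n) \<times> int) set" where
  "null_frequencies =
     {(k, t). \<exists>v s. (norm (rvec v))\<^sup>2 = (real_of_int s)\<^sup>2 \<and> (real_of_int s)\<^sup>2 \<noteq> 0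
        \<and> rvec v \<bullet> rvec k + real_of_int s * real_of_int t = 0}"

end

theory Submission
  imports Defs
begin

text \<open>
  Null geodesics of \<open>g\<close> are affine, so the closed ones are the lines in the directions of the null
  lattice; their reparametrizations by the primitive of \<open>c\<close> are closed null geodesics of \<open>c g\<close>.
  Averaging along the direction \<open>w\<close> fixes the character of frequency \<open>\<kappa>\<close> if \<open>\<kappa> \<bullet> w = 0\<close> and kills it
  otherwise. Convolution with a positive trigonometric kernel, a normalized power of
  \<open>\<Sum>\<^sub>b (1 + cos (2 \<pi> x\<^sub>b))\<close> concentrated near the lattice, approximates a function together with
  finitely many derivatives by trigonometric polynomials with no new frequencies; hence an average
  vanishes iff the coefficients with \<open>\<kappa> \<bullet> w = 0\<close> do, for functions and distributions alike.

  For \<open>n\<^sub>1 = 3\<close>, null vectors are Hermitian \<open>2 \<times> 2\<close> matrices of rank one and \<open>(k, t)\<close> is a Hermitian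
  matrix of determinant \<open>t\<^sup>2 - \<bar>k\<bar>\<^sup>2\<close>, whose form is isotropic over \<open>\<rat>(i)\<close> if \<open>\<bar>k\<bar>\<^sup>2 - t\<^sup>2\<close> is a norm.
  Conversely a reflection moves the null direction to a coordinate axis, which exhibits
  \<open>\<bar>k\<bar>\<^sup>2 - t\<^sup>2\<close> as a sum of two rational squares; by descent it is a sum of two integer squares.
\<close>


section \<open>Integral null vectors\<close>

text \<open>\<open>K\<close> is a union of Euclidean hyperplanes, one for each null
  \<open>w\<close>, so everything reduces to a single \<open>w\<close>. The obstacle is that the
  Fourier series of a continuous function need not converge, while a distribution controls finitely
  many derivatives of its test functions. One kernel must therefore approximate a whole finite
  family uniformly, and convolution with it must commute with derivatives. With a trigonometric
  kernel the convolution is moreover a finite sum, so that its average along \<open>w\<close> is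
  known exactly before any limit is taken. This is used in two ways: the spectrum of a continuous
  function in question misses the hyperplane, whereas a test function has arbitrary spectrum, and it
  is its average that lives on the hyperplane, where the distribution vanishes. The closed null
  geodesics of \<open>c g\<close> are never classified: an integral over one of them is defined
  through a geodesic of \<open>g\<close>, so it suffices that each null line carries one.\<close>

text \<open>Davenport-Cassels descent. A rational point of the circle of squared radius
  \<open>n\<close> and the nearest integer point span a line, whose second intersection with the
  circle has a denominator at most half as large, because the squared distance of the two points is
  at most 1/2.\<close>

lemma sum_two_squares_rational_imp_int:
  fixes d n x y :: int
  assumes "d > 0" "d\<^sup>2 * n = x\<^sup>2 + y\<^sup>2"
  shows "\<exists>a b :: int. n = a\<^sup>2 + b\<^sup>2"
  using assms
proof (induction "nat d" arbitrary: d x y rule: less_induct)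
  case less
  define x0 where "x0 = round (real_of_int x / d)"
  define y0 where "y0 = round (real_of_int y / d)"
  define N where "N = x0\<^sup>2 + y0\<^sup>2"
  define T where "T = x * x0 + y * y0"
  \<comment> \<open>\<open>d'\<close> is \<open>d\<close> times the squared distance between
    \<open>(x, y) / d\<close> and \<open>(x0, y0)\<close>; each of the two rounding errors
    contributes at most 1/4 to that square.\<close>
  define d' where "d' = n * d - 2 * T + N * d"
  have d: "d > 0" and eq: "d\<^sup>2 * n = x\<^sup>2 + y\<^sup>2" using less.prems by auto
  have dd': "d * d' = (x - d * x0)\<^sup>2 + (y - d * y0)\<^sup>2"
    using eq unfolding d'_def T_def N_def by (simp add: algebra_simps power2_eq_square)
  have rnd: "2 * \<bar>z - d * round (real_of_int z / d)\<bar> \<le> d" for z :: int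
  proof -
    have "\<bar>real_of_int z / d - of_int (round (real_of_int z / d))\<bar> \<le> 1/2"
      using of_int_round_abs_le[of "real_of_int z / d"] by linarith
    then have "real_of_int d * \<bar>real_of_int z / d - of_int (round (real_of_int z / d))\<bar> \<le> d * (1/2)"
      using d by (intro mult_left_mono) simp_all
    moreover have "real_of_int d * \<bar>u\<bar> = \<bar>d * u\<bar>" for u :: real
      using d by (simp add: abs_mult)
    moreover have "d * (real_of_int z / d - of_int (round (real_of_int z / d)))
        = real_of_int z - d * of_int (round (real_of_int z / d))"
      using d by (simp add: right_diff_distrib)
    ultimately have "\<bar>real_of_int z - d * of_int (round (real_of_int z / d))\<bar> \<le> d * (1/2)"
      by metis
    then have "real_of_int (2 * \<bar>z - d * round (real_of_int z / d)\<bar>) \<le> real_of_int d"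
      by simp
    then show ?thesis by (simp only: of_int_le_iff)
  qed
  have sq: "4 * (z - d * round (real_of_int z / d))\<^sup>2 \<le> d\<^sup>2" for z :: int
  proof -
    have "(2 * \<bar>z - d * round (real_of_int z / d)\<bar>)\<^sup>2 \<le> d\<^sup>2"
      using rnd[of z] by (intro power_mono) auto
    then show ?thesis by (simp add: power_mult_distrib)
  qed
  have "4 * (d * d') \<le> 2 * d\<^sup>2"
    using sq[of x] sq[of y] dd' unfolding x0_def y0_def by simp
  then have "d * (4 * d') \<le> d * (2 * d)" by (simp add: power2_eq_square algebra_simps)
  then have le: "4 * d' \<le> 2 * d" using d by simp
  have "d * d' \<ge> 0" using dd' by simp
  then have ge: "d' \<ge> 0" using d by (simp add: zero_le_mult_iff)
  show ?case
  proof (cases "d' = 0")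
    case True
    then have "x = d * x0" "y = d * y0" using dd' by (auto simp: sum_power2_eq_zero_iff)
    then have "d\<^sup>2 * n = d\<^sup>2 * (x0\<^sup>2 + y0\<^sup>2)" using eq by (simp add: power_mult_distrib algebra_simps)
    then show ?thesis using d by auto
  next
    case False
    \<comment> \<open>By Vieta the line meets the circle again at
      \<open>(1 - m) (x0, y0) + m (x, y) / d\<close> with \<open>m = a d / d'\<close>. Over the
      denominator \<open>d'\<close> the coefficients become \<open>b\<close> for
      \<open>(x0, y0)\<close> and \<open>a\<close> for \<open>(x, y)\<close>.\<close>
    define a where "a = N - n"
    define b where "b = 2 * (n * d - T)"
    have d'ab: "d' = a * d + b" unfolding d'_def a_def b_def by (simp add: algebra_simps)
    have "(a * x + b * x0)\<^sup>2 + (a * y + b * y0)\<^sup>2 = a\<^sup>2 * (x\<^sup>2 + y\<^sup>2) + b * (2 * a * T + b * N)"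
      unfolding T_def N_def by (simp add: algebra_simps power2_eq_square)
    also have "\<dots> = a\<^sup>2 * (d\<^sup>2 * n) + b * (2 * a * T + b * (a + n))"
      using eq unfolding a_def by simp
    also have "\<dots> = d'\<^sup>2 * n"
      unfolding d'ab using b_def by algebra
    finally have "d'\<^sup>2 * n = (a * x + b * x0)\<^sup>2 + (a * y + b * y0)\<^sup>2" ..
    moreover have "nat d' < nat d" "d' > 0" using le ge d False by auto
    ultimately show ?thesis using less.hyps by blast
  qed
qed

section \<open>The frequency set: inclusions and low dimensions\<close>

lemma norm_rvec_squared: "(norm (rvec v))\<^sup>2 = real_of_int (\<Sum>i\<in>UNIV. (v $ i)\<^sup>2)"
  unfolding power2_norm_eq_inner inner_vec_def rvec_def by (simp add: power2_eq_square)

lemma inner_rvec: "rvec v \<bullet> rvec k = real_of_int (\<Sum>i\<in>UNIV. v $ i * k $ i)"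
  by (simp add: inner_vec_def rvec_def)

lemma null_frequencies_iff:
  "(k, t) \<in> null_frequencies \<longleftrightarrow> (\<exists>v s. (\<Sum>i\<in>UNIV. (v $ i)\<^sup>2) = s\<^sup>2 \<and> s \<noteq> 0
      \<and> (\<Sum>i\<in>UNIV. v $ i * k $ i) + s * t = 0)"
proof -
  have 1: "real_of_int a = (real_of_int b)\<^sup>2 \<longleftrightarrow> a = b\<^sup>2" for a b :: int
    by (metis of_int_eq_iff of_int_power)
  have 2: "real_of_int a + real_of_int s * real_of_int t = 0 \<longleftrightarrow> a + s * t = 0" for a s t :: int
    by (metis of_int_0_eq_iff of_int_add of_int_mult)
  have 3: "(real_of_int s)\<^sup>2 \<noteq> 0 \<longleftrightarrow> s \<noteq> 0" for s :: int by simp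
  show ?thesis
    unfolding null_frequencies_def norm_rvec_squared inner_rvec 1 2 3 by simp
qed

text \<open>A frequency on the cone is orthogonal to its time reflection \<open>(k, - t)\<close>,
  which is null itself. This witness fails only at the apex, where its time component would be 0 and
  any null vector serves.\<close>

lemma light_cone_subset_null_frequencies:
  "{(k, t). \<bar>real_of_int t\<bar> = norm (rvec (k::int^'n))} \<subseteq> null_frequencies"
proof safe
  fix k :: "int^'n" and t :: int
  assume eq: "\<bar>real_of_int t\<bar> = norm (rvec k)"
  have sq: "(norm (rvec k))\<^sup>2 = (real_of_int t)\<^sup>2" using eq by (metis power2_abs)
  show "(k, t) \<in> null_frequencies"
  proof (cases "t = 0")
    case True
    then have "rvec k = 0" using eq by simp
    moreover have "rvec (axis undefined 1 :: int^'n) = axis undefined 1"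
      by (simp add: rvec_def axis_def vec_eq_iff)
    then have "norm (rvec (axis undefined 1 :: int^'n)) = 1" by simp
    ultimately show ?thesis using True unfolding null_frequencies_def
      by (auto intro!: exI[of _ "axis undefined 1 :: int^'n"] exI[of _ "1::int"])
  next
    case False
    moreover have "rvec k \<bullet> rvec k + real_of_int (- t) * real_of_int t = 0"
      using sq unfolding power2_norm_eq_inner by (simp add: power2_eq_square)
    ultimately show ?thesis using sq unfolding null_frequencies_def
      by (auto intro!: exI[of _ k] exI[of _ "- t"])
  qed
qed

lemma null_frequencies_subset_spacelike:
  "null_frequencies \<subseteq> {(k, t). \<bar>real_of_int t\<bar> \<le> norm (rvec (k::int^'n))}"
proof safe
  fix k :: "int^'n" and t :: int
  assume "(k, t) \<in> null_frequencies"
  then obtain v s where vs: "(norm (rvec v))\<^sup>2 = (real_of_int s)\<^sup>2" "(real_of_int s)\<^sup>2 \<noteq> 0"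
     "rvec v \<bullet> rvec k + real_of_int s * real_of_int t = 0"
    unfolding null_frequencies_def by auto
  have nv: "norm (rvec v) = \<bar>real_of_int s\<bar>" using vs(1)
    by (metis norm_ge_zero real_sqrt_abs real_sqrt_unique)
  have "\<bar>real_of_int s\<bar> * \<bar>real_of_int t\<bar> = \<bar>rvec v \<bullet> rvec k\<bar>"
    using vs(3) by (metis abs_minus_cancel abs_mult add_eq_0_iff)
  also have "\<dots> \<le> \<bar>real_of_int s\<bar> * norm (rvec k)"
    using Cauchy_Schwarz_ineq2[of "rvec v" "rvec k"] nv by simp
  finally show "\<bar>real_of_int t\<bar> \<le> norm (rvec k)" using vs(2) by simp
qed

lemma null_frequencies_card_1:
  assumes "CARD('n) = 1"
  shows "(null_frequencies :: ((int^'n) \<times> int) set) = {(k, t). \<bar>real_of_int t\<bar> = norm (rvec k)}"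
proof
  obtain j :: 'n where U: "(UNIV :: 'n set) = {j}" using assms by (rule card_1_singletonE)
  show "null_frequencies \<subseteq> {(k :: int^'n, t). \<bar>real_of_int t\<bar> = norm (rvec k)}"
  proof safe
    fix k :: "int^'n" and t :: int
    assume "(k, t) \<in> null_frequencies"
    then obtain v :: "int^'n" and s where vs: "(v $ j)\<^sup>2 = s\<^sup>2" "s \<noteq> 0" "v $ j * k $ j + s * t = 0"
      unfolding null_frequencies_iff U by auto
    have "s * (t - k $ j) = 0 \<or> s * (t + k $ j) = 0" using vs(1,3)
      by (auto simp: power2_eq_iff algebra_simps)
    then have "t\<^sup>2 = (k $ j)\<^sup>2" using vs(2) by (auto simp: power2_eq_iff)
    then have "real_of_int ((k $ j)\<^sup>2) = (real_of_int t)\<^sup>2" by (metis of_int_power)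
    moreover have "(norm (rvec k))\<^sup>2 = real_of_int ((k $ j)\<^sup>2)" unfolding norm_rvec_squared U by simp
    ultimately have "(norm (rvec k))\<^sup>2 = (real_of_int t)\<^sup>2" by simp
    then show "\<bar>real_of_int t\<bar> = norm (rvec k)"
      by (metis norm_ge_zero real_sqrt_abs real_sqrt_unique)
  qed
qed (rule light_cone_subset_null_frequencies)

text \<open>The real \<open>sqrt\<close> is odd, so a negative \<open>m\<close> has a negative root.
  Hence membership in \<nat> also encodes \<open>m \<ge> 0\<close>, that is, the frequency is not
  timelike.\<close>

lemma sqrt_of_int_in_Nats_iff: "sqrt (real_of_int m) \<in> \<nat> \<longleftrightarrow> (\<exists>d::int. m = d\<^sup>2)"
proof
  assume "sqrt (real_of_int m) \<in> \<nat>"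
  then obtain n :: nat where n: "sqrt (real_of_int m) = real n" by (auto elim: Nats_cases)
  then have "real_of_int m \<ge> 0" using of_nat_0_le_iff[of n, where ?'a = real] real_sqrt_ge_0_iff by metis
  then have "real_of_int m = (real n)\<^sup>2" using n by (metis real_sqrt_pow2)
  then have "m = (int n)\<^sup>2" by (metis of_int_eq_iff of_int_of_nat_eq of_int_power)
  then show "\<exists>d. m = d\<^sup>2" ..
next
  assume "\<exists>d. m = d\<^sup>2"
  then obtain d where d: "m = d\<^sup>2" ..
  have "sqrt (real_of_int m) = real (nat \<bar>d\<bar>)" unfolding d by simp
  then show "sqrt (real_of_int m) \<in> \<nat>" using of_nat_in_Nats by metis
qed

lemma square_imp_int_square:
  fixes s m e :: int
  assumes "s \<noteq> 0" "e\<^sup>2 = s\<^sup>2 * m"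
  shows "\<exists>d. m = d\<^sup>2"
proof -
  have "s\<^sup>2 dvd e\<^sup>2" using assms(2) by simp
  then have "s dvd e" by simp
  then obtain d where "e = s * d" ..
  then show ?thesis using assms by (auto simp: power_mult_distrib)
qed

text \<open>Lagrange's identity \<open>|v|^2 |k|^2 = (v . k)^2 + det(v, k)^2\<close> together with
  \<open>|v|^2 = s^2\<close> and \<open>v . k = - s t\<close> exhibits
  \<open>s^2 (|k|^2 - t^2)\<close> as the square of a determinant.\<close>

lemma null_frequencies_card_2:
  assumes "CARD('n) = 2"
  shows "(null_frequencies :: ((int^'n) \<times> int) set) =
    {(k, t). sqrt ((norm (rvec k))\<^sup>2 - \<bar>real_of_int t\<bar>\<^sup>2) \<in> \<nat>}"
proof -
  obtain i j :: 'n where ij: "(UNIV :: 'n set) = {i, j}" "i \<noteq> j"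
    using assms by (meson card_2_iff)
  have "(k, t) \<in> null_frequencies \<longleftrightarrow> sqrt ((norm (rvec k))\<^sup>2 - \<bar>real_of_int t\<bar>\<^sup>2) \<in> \<nat>"
    (is "?L \<longleftrightarrow> ?R") for k :: "int^'n" and t :: int
  proof -
    have R: "?R \<longleftrightarrow> (\<exists>d. (k $ i)\<^sup>2 + (k $ j)\<^sup>2 - t\<^sup>2 = d\<^sup>2)"
      using sqrt_of_int_in_Nats_iff[of "(k $ i)\<^sup>2 + (k $ j)\<^sup>2 - t\<^sup>2"] ij(2)
      unfolding norm_rvec_squared ij(1) by simp
    have L: "?L \<longleftrightarrow> (\<exists>v::int^'n. \<exists>s. (v $ i)\<^sup>2 + (v $ j)\<^sup>2 = s\<^sup>2 \<and> s \<noteq> 0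
        \<and> v $ i * k $ i + v $ j * k $ j + s * t = 0)"
      using ij(2) unfolding null_frequencies_iff ij(1) by simp
    show ?thesis unfolding L R
    proof safe
      fix v :: "int^'n" and s
      assume vs: "(v $ i)\<^sup>2 + (v $ j)\<^sup>2 = s\<^sup>2" "s \<noteq> 0" "v $ i * k $ i + v $ j * k $ j + s * t = 0"
      have "(v $ i * k $ j - v $ j * k $ i)\<^sup>2 = s\<^sup>2 * ((k $ i)\<^sup>2 + (k $ j)\<^sup>2 - t\<^sup>2)"
        using vs(1,3) by algebra
      then show "\<exists>d. (k $ i)\<^sup>2 + (k $ j)\<^sup>2 - t\<^sup>2 = d\<^sup>2"
        using square_imp_int_square vs(2) by blast
    next
      fix d
      assume d: "(k $ i)\<^sup>2 + (k $ j)\<^sup>2 - t\<^sup>2 = d\<^sup>2"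
      define v :: "int \<Rightarrow> int \<Rightarrow> int^'n" where "v a b = (\<chi> l. if l = i then a else b)" for a b
      have v: "v a b $ i = a" "v a b $ j = b" for a b using ij(2) by (auto simp: v_def)
      show "\<exists>v::int^'n. \<exists>s. (v $ i)\<^sup>2 + (v $ j)\<^sup>2 = s\<^sup>2 \<and> s \<noteq> 0
        \<and> v $ i * k $ i + v $ j * k $ j + s * t = 0"
      proof (cases "k $ i = 0 \<and> k $ j = 0")
        case True
        then have "d\<^sup>2 + t\<^sup>2 = 0" using d by (simp flip: d)
        then have "t = 0" by (simp only: sum_power2_eq_zero_iff)
        then show ?thesis using True
          by (intro exI[of _ "v 1 0"] exI[of _ 1]) (auto simp: v)
      next
        case False
        then have "(k $ i)\<^sup>2 + (k $ j)\<^sup>2 \<noteq> 0" by (simp add: sum_power2_eq_zero_iff)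
        \<comment> \<open>In complex notation the witness is \<open>v = k (- t + i d)\<close> with
          \<open>s = |k|^2\<close>; since \<open>t^2 + d^2 = |k|^2\<close>, it has modulus
          \<open>s\<close>, and \<open>v . k = - t |k|^2\<close>. It degenerates only for
          \<open>k = 0\<close>, which is the other case.\<close>
        moreover have "(- t * k $ i - d * k $ j)\<^sup>2 + (- t * k $ j + d * k $ i)\<^sup>2
             = ((k $ i)\<^sup>2 + (k $ j)\<^sup>2)\<^sup>2"
          using d by algebra
        ultimately show ?thesis
          by (intro exI[of _ "v (- t * k $ i - d * k $ j) (- t * k $ j + d * k $ i)"]
                exI[of _ "(k $ i)\<^sup>2 + (k $ j)\<^sup>2"])
             (simp add: v, simp add: algebra_simps power2_eq_square)
      qed
    qed
  qed
  then show ?thesis by auto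
qed

lemma null_frequencies_card_3:
  assumes "CARD('n) = 3"
  shows "(null_frequencies :: ((int^'n) \<times> int) set) =
    {(k, t). \<exists>a b :: int.
       (norm (rvec k))\<^sup>2 - \<bar>real_of_int t\<bar>\<^sup>2 = (real_of_int a)\<^sup>2 + (real_of_int b)\<^sup>2}"
proof -
  obtain i j l :: 'n where ijl: "(UNIV :: 'n set) = {i, j, l}" "i \<noteq> j" "i \<noteq> l" "j \<noteq> l"
    using assms by (metis card_3_iff)
  have "(k, t) \<in> null_frequencies \<longleftrightarrow> (\<exists>a b :: int.
       (norm (rvec k))\<^sup>2 - \<bar>real_of_int t\<bar>\<^sup>2 = (real_of_int a)\<^sup>2 + (real_of_int b)\<^sup>2)"
    (is "?L \<longleftrightarrow> ?R") for k :: "int^'n" and t :: int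
  proof -
    have cast: "real_of_int A - \<bar>real_of_int t\<bar>\<^sup>2 = (real_of_int a)\<^sup>2 + (real_of_int b)\<^sup>2
        \<longleftrightarrow> A - t\<^sup>2 = a\<^sup>2 + b\<^sup>2" for A a b :: int
      unfolding power2_abs by (metis (no_types) of_int_add of_int_diff of_int_eq_iff of_int_power)
    have R: "?R \<longleftrightarrow> (\<exists>a b. (k $ i)\<^sup>2 + (k $ j)\<^sup>2 + (k $ l)\<^sup>2 - t\<^sup>2 = a\<^sup>2 + b\<^sup>2)"
      using ijl(2-4) unfolding norm_rvec_squared ijl(1) cast by (simp add: algebra_simps)
    have L: "?L \<longleftrightarrow> (\<exists>v::int^'n. \<exists>s. (v $ i)\<^sup>2 + (v $ j)\<^sup>2 + (v $ l)\<^sup>2 = s\<^sup>2 \<and> s \<noteq> 0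
        \<and> v $ i * k $ i + v $ j * k $ j + v $ l * k $ l + s * t = 0)"
      using ijl(2-4) unfolding null_frequencies_iff ijl(1) by (simp add: algebra_simps)
    show ?thesis unfolding L R
    proof safe
      fix v :: "int^'n" and s
      assume vs: "(v $ i)\<^sup>2 + (v $ j)\<^sup>2 + (v $ l)\<^sup>2 = s\<^sup>2" "s \<noteq> 0"
        "v $ i * k $ i + v $ j * k $ j + v $ l * k $ l + s * t = 0"
      show "\<exists>a b. (k $ i)\<^sup>2 + (k $ j)\<^sup>2 + (k $ l)\<^sup>2 - t\<^sup>2 = a\<^sup>2 + b\<^sup>2"
      \<comment> \<open>The reflection needed in the second case degenerates if \<open>v / s\<close>
        already is the third basis vector. Then \<open>t = - k $ l\<close>, and the two other
        squares of \<open>k\<close> remain.\<close>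
      proof (cases "s = v $ l")
        case True
        then have "v $ i = 0" "v $ j = 0" using vs(1) by (auto simp: sum_power2_eq_zero_iff)
        then have "s * (k $ l + t) = 0" using vs(3) True by (simp add: algebra_simps)
        then have "t = - k $ l" using vs(2) by auto
        then show ?thesis by auto
      next
        case False
        define r where "r = s - v $ l"
        \<comment> \<open>\<open>(x, y, - r * t)\<close> is \<open>r\<close> times the image of \<open>k\<close> under the rational reflection
          that maps the unit vector \<open>v / s\<close> to the third basis vector\<close>
        define x where "x = r * k $ i + v $ i * (t + k $ l)"
        define y where "y = r * k $ j + v $ j * (t + k $ l)"
        have "s * (r\<^sup>2 * ((k $ i)\<^sup>2 + (k $ j)\<^sup>2 + (k $ l)\<^sup>2 - t\<^sup>2)) = s * (x\<^sup>2 + y\<^sup>2)"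
          unfolding x_def y_def r_def using vs(1,3) by algebra
        then have "r\<^sup>2 * ((k $ i)\<^sup>2 + (k $ j)\<^sup>2 + (k $ l)\<^sup>2 - t\<^sup>2) = x\<^sup>2 + y\<^sup>2"
          using vs(2) by simp
        then have "\<bar>r\<bar>\<^sup>2 * ((k $ i)\<^sup>2 + (k $ j)\<^sup>2 + (k $ l)\<^sup>2 - t\<^sup>2) = x\<^sup>2 + y\<^sup>2" by simp
        moreover have "\<bar>r\<bar> > 0" using False by (simp add: r_def)
        ultimately show ?thesis using sum_two_squares_rational_imp_int by blast
      qed
    next
      fix a b
      assume ab: "(k $ i)\<^sup>2 + (k $ j)\<^sup>2 + (k $ l)\<^sup>2 - t\<^sup>2 = a\<^sup>2 + b\<^sup>2"
      define v :: "int \<Rightarrow> int \<Rightarrow> int \<Rightarrow> int^'n"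
        where "v p q r = (\<chi> m. if m = i then p else if m = j then q else r)" for p q r
      have v: "v p q r $ i = p" "v p q r $ j = q" "v p q r $ l = r" for p q r
        using ijl(2-4) by (auto simp: v_def)
      show "\<exists>v::int^'n. \<exists>s. (v $ i)\<^sup>2 + (v $ j)\<^sup>2 + (v $ l)\<^sup>2 = s\<^sup>2 \<and> s \<noteq> 0
        \<and> v $ i * k $ i + v $ j * k $ j + v $ l * k $ l + s * t = 0"
      \<comment> \<open>If this diagonal entry of the Hermitian matrix vanishes, its form is
        isotropic at a basis vector, which gives the null vector along the third axis. Otherwise the
        square of the entry keeps the new \<open>s\<close> positive.\<close>
      proof (cases "t + k $ l = 0")
        case True
        then show ?thesis by (intro exI[of _ "v 0 0 1"] exI[of _ 1]) (auto simp: v)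
      next
        case False
        \<comment> \<open>The Hermitian matrix with entries \<open>A = t + k\<^sub>3\<close>, \<open>B = k\<^sub>1 + i k\<^sub>2\<close>, \<open>C = t - k\<^sub>3\<close> has
          determinant \<open>- \<bar>a + i b\<bar>\<^sup>2\<close>, so its form vanishes at \<open>(a + i b - B, A)\<close>;
          \<open>v\<close> and \<open>s\<close> are the coordinates of the corresponding rank one matrix.\<close>
        define A where "A = t + k $ l"
        define p where "p = a - k $ i"
        define q where "q = b - k $ j"
        have "p\<^sup>2 + q\<^sup>2 + A\<^sup>2 > 0" using False
          by (simp add: A_def add_nonneg_pos)
        moreover have "(2 * A * p)\<^sup>2 + (2 * A * q)\<^sup>2 + (p\<^sup>2 + q\<^sup>2 - A\<^sup>2)\<^sup>2 = (p\<^sup>2 + q\<^sup>2 + A\<^sup>2)\<^sup>2"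
          by algebra
        moreover have "2 * A * p * k $ i + 2 * A * q * k $ j + (p\<^sup>2 + q\<^sup>2 - A\<^sup>2) * k $ l
            + (p\<^sup>2 + q\<^sup>2 + A\<^sup>2) * t = 0"
          using ab unfolding A_def p_def q_def by algebra
        ultimately show ?thesis
          by (intro exI[of _ "v (2 * A * p) (2 * A * q) (p\<^sup>2 + q\<^sup>2 - A\<^sup>2)"]
                exI[of _ "p\<^sup>2 + q\<^sup>2 + A\<^sup>2"]) (auto simp: v)
      qed
    qed
  qed
  then show ?thesis by auto
qed


section \<open>Smooth functions\<close>

abbreviation partial :: "'a::euclidean_space \<Rightarrow> ('a \<Rightarrow> 'b::real_normed_vector) \<Rightarrow> 'a \<Rightarrow> 'b" where
  "partial b f \<equiv> \<lambda>x. frechet_derivative f (at x) b"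

text \<open>\<open>iter_partial\<close> applies the head of the list last, whereas an induction on
  the order strips the innermost derivative, which is the last element, so that its hypothesis
  speaks about first derivatives of \<open>f\<close>.\<close>

lemma iter_partial_snoc: "iter_partial (bs @ [b]) f = iter_partial bs (partial b f)"
  by (induction bs) auto

text \<open>Smoothness alone offers no induction: derivatives of products, inverses and square roots
  contain the undifferentiated functions again. At finite order these are covered by the hypothesis
  one order lower.\<close>

primrec diff_upto :: "nat \<Rightarrow> ('a::euclidean_space \<Rightarrow> 'b::real_normed_vector) \<Rightarrow> bool" where
  "diff_upto 0 f \<longleftrightarrow> f differentiable_on UNIV"
| "diff_upto (Suc n) f \<longleftrightarrow> f differentiable_on UNIV \<and> (\<forall>b\<in>Basis. diff_upto n (partial b f))"

lemma all_lists_upto_Suc_iff: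
  "(\<forall>bs\<in>lists A. length bs \<le> Suc n \<longrightarrow> P bs) \<longleftrightarrow>
     P [] \<and> (\<forall>b\<in>A. \<forall>bs\<in>lists A. length bs \<le> n \<longrightarrow> P (bs @ [b]))"
  (is "?L \<longleftrightarrow> ?R")
proof
  assume R: ?R
  show ?L
  proof (intro ballI impI)
    fix bs assume "bs \<in> lists A" "length bs \<le> Suc n"
    then show "P bs" using R by (cases bs rule: rev_cases) auto
  qed
qed simp

lemma diff_upto_iff:
  "diff_upto n f \<longleftrightarrow>
     (\<forall>bs\<in>lists Basis. length bs \<le> n \<longrightarrow> iter_partial bs f differentiable_on UNIV)"
proof (induction n arbitrary: f)
  case (Suc n)
  show ?case unfolding all_lists_upto_Suc_iff iter_partial_snoc by (simp add: Suc)
qed auto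

lemma smooth_fun_iff_diff_upto: "smooth_fun f \<longleftrightarrow> (\<forall>n. diff_upto n f)"
  unfolding smooth_fun_def diff_upto_iff by blast

lemma diff_upto_imp_differentiable: "diff_upto n f \<Longrightarrow> f differentiable (at x)"
  by (cases n) (auto simp: differentiable_on_def)

lemma diff_upto_SucD: "diff_upto (Suc n) f \<Longrightarrow> diff_upto n f"
  unfolding diff_upto_iff by simp

text \<open>Coinduction suits families that are closed under differentiation, such as the multiples
  of a character or the averages of smooth functions.\<close>

lemma smooth_fun_coinduct:
  assumes "P f"
    and "\<And>g x. P g \<Longrightarrow> g differentiable (at x)"
    and "\<And>g b. P g \<Longrightarrow> b \<in> Basis \<Longrightarrow> P (partial b g)"
  shows "smooth_fun f"
proof -
  have "P g \<Longrightarrow> diff_upto n g" for n g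
    by (induction n arbitrary: g) (auto simp: assms(2,3) differentiable_on_def)
  then show ?thesis using assms(1) by (auto simp: smooth_fun_iff_diff_upto)
qed

lemma smooth_fun_differentiable: "smooth_fun f \<Longrightarrow> f differentiable (at x)"
  using diff_upto_imp_differentiable smooth_fun_iff_diff_upto by blast

lemma smooth_fun_partial: "smooth_fun f \<Longrightarrow> b \<in> Basis \<Longrightarrow> smooth_fun (partial b f)"
  unfolding smooth_fun_iff_diff_upto using diff_upto.simps(2) by blast

lemma smooth_fun_iter_partial:
  "smooth_fun f \<Longrightarrow> bs \<in> lists Basis \<Longrightarrow> smooth_fun (iter_partial bs f)"
  by (induction bs) (auto intro: smooth_fun_partial)

lemma differentiable_imp_continuous_on_UNIV:
  "(\<And>x. f differentiable (at x)) \<Longrightarrow> continuous_on UNIV f"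
  by (simp add: differentiable_imp_continuous_within continuous_on_eq_continuous_within)

lemma smooth_fun_continuous_on: "smooth_fun f \<Longrightarrow> continuous_on UNIV f"
  by (simp add: differentiable_imp_continuous_on_UNIV smooth_fun_differentiable)

lemma partial_eqI: "(f has_derivative f') (at x) \<Longrightarrow> frechet_derivative f (at x) b = f' b"
  using frechet_derivative_at by metis

lemma partial_add:
  assumes "\<And>x. f differentiable (at x)" "\<And>x. g differentiable (at x)"
  shows "partial b (\<lambda>x. f x + g x) = (\<lambda>x. partial b f x + partial b g x)"
  using assms unfolding frechet_derivative_works
  by (intro ext partial_eqI has_derivative_add)

lemma partial_scaleR:
  assumes "\<And>x. f differentiable (at x)" "\<And>x. g differentiable (at x)"
  shows "partial b (\<lambda>x. f x *\<^sub>R g x) = (\<lambda>x. partial b f x *\<^sub>R g x + f x *\<^sub>R partial b g x)"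
proof
  fix x
  have "((\<lambda>x. f x *\<^sub>R g x) has_derivative
      (\<lambda>h. f x *\<^sub>R frechet_derivative g (at x) h + frechet_derivative f (at x) h *\<^sub>R g x)) (at x)"
    using assms unfolding frechet_derivative_works by (intro has_derivative_scaleR)
  from partial_eqI[OF this]
  show "partial b (\<lambda>x. f x *\<^sub>R g x) x = partial b f x *\<^sub>R g x + f x *\<^sub>R partial b g x"
    by simp
qed

lemma diff_upto_add: "diff_upto n f \<Longrightarrow> diff_upto n g \<Longrightarrow> diff_upto n (\<lambda>x. f x + g x)"
proof (induction n arbitrary: f g)
  case (Suc n)
  note d = Suc.prems[THEN diff_upto_imp_differentiable]
  show ?case using Suc d by (auto simp: partial_add[OF d] differentiable_on_def)
qed (auto simp: differentiable_on_def)

lemma diff_upto_scaleR: "diff_upto n f \<Longrightarrow> diff_upto n g \<Longrightarrow> diff_upto n (\<lambda>x. f x *\<^sub>R g x)"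
proof (induction n arbitrary: f g)
  case (Suc n)
  note d = Suc.prems[THEN diff_upto_imp_differentiable]
  note l = Suc.prems[THEN diff_upto_SucD]
  show ?case using Suc d l
    by (auto simp: partial_scaleR[OF d] differentiable_on_def intro!: diff_upto_add)
qed (auto simp: differentiable_on_def)

lemma smooth_fun_add: "smooth_fun f \<Longrightarrow> smooth_fun g \<Longrightarrow> smooth_fun (\<lambda>x. f x + g x)"
  by (simp add: smooth_fun_iff_diff_upto diff_upto_add)

lemma smooth_fun_scaleR: "smooth_fun f \<Longrightarrow> smooth_fun g \<Longrightarrow> smooth_fun (\<lambda>x. f x *\<^sub>R g x)"
  by (simp add: smooth_fun_iff_diff_upto diff_upto_scaleR)

lemma smooth_fun_bounded_linear:
  fixes f :: "'a::euclidean_space \<Rightarrow> 'b::real_normed_vector" and L :: "'b \<Rightarrow> 'c::real_normed_vector"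
  assumes "bounded_linear L" "smooth_fun f"
  shows "smooth_fun (\<lambda>x. L (f x))"
proof (rule smooth_fun_coinduct[where P = "\<lambda>h. \<exists>g. h = (\<lambda>x. L (g x)) \<and> smooth_fun g"])
  fix h :: "'a \<Rightarrow> 'c" and x b :: 'a assume "\<exists>g. h = (\<lambda>x. L (g x)) \<and> smooth_fun g"
  then obtain g where h: "h = (\<lambda>x. L (g x))" and g: "smooth_fun g" by blast
  have D: "(h has_derivative (\<lambda>v. L (frechet_derivative g (at x) v))) (at x)" for x
    unfolding h using smooth_fun_differentiable[OF g]
    by (intro bounded_linear.has_derivative[OF assms(1)]) (simp add: frechet_derivative_works)
  show "h differentiable (at x)" using D differentiable_def by blast
  assume "b \<in> Basis"
  then show "\<exists>g. partial b h = (\<lambda>x. L (g x)) \<and> smooth_fun g"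
    using partial_eqI[OF D] smooth_fun_partial[OF g] by auto
qed (use assms in auto)

lemma partial_diff:
  assumes "\<And>x. f differentiable (at x)" "\<And>x. g differentiable (at x)"
  shows "partial b (\<lambda>x. f x - g x) = (\<lambda>x. partial b f x - partial b g x)"
  using assms unfolding frechet_derivative_works
  by (intro ext partial_eqI has_derivative_diff)

lemma iter_partial_diff:
  assumes "smooth_fun f" "smooth_fun g"
  shows "bs \<in> lists Basis \<Longrightarrow>
    iter_partial bs (\<lambda>x. f x - g x) = (\<lambda>x. iter_partial bs f x - iter_partial bs g x)"
proof (induction bs)
  case (Cons b bs)
  then show ?case
    using assms[THEN smooth_fun_iter_partial, THEN smooth_fun_differentiable, of bs]
    by (simp add: partial_diff)
qed simp

lemma smooth_fun_diff: "smooth_fun f \<Longrightarrow> smooth_fun g \<Longrightarrow> smooth_fun (\<lambda>x. f x - g x)"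
  using smooth_fun_add[OF _ smooth_fun_bounded_linear[OF bounded_linear_minus[OF bounded_linear_ident]], of f g]
  by simp

lemma diff_upto_const: "diff_upto n (\<lambda>x. a)"
  by (induction n arbitrary: a) auto

text \<open>A partial derivative of \<open>inverse f\<close> is minus the product of
  \<open>partial b f\<close> with two factors \<open>inverse f\<close>, and these are needed only to
  one order less.\<close>

lemma diff_upto_inverse:
  fixes f :: "'a::euclidean_space \<Rightarrow> real"
  assumes nz: "\<And>x. f x \<noteq> 0"
  shows "diff_upto n f \<Longrightarrow> diff_upto n (\<lambda>x. inverse (f x))"
proof (induction n)
  case 0
  then show ?case using nz by (auto simp: differentiable_on_def intro!: differentiable_inverse)
next
  case (Suc n)
  note d = diff_upto_imp_differentiable[OF Suc.prems]
  have "((\<lambda>x. inverse (f x)) has_derivative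
      (\<lambda>h. - (inverse (f x) * frechet_derivative f (at x) h * inverse (f x)))) (at x)" for x
    using d nz by (intro Deriv.has_derivative_inverse) (auto simp: frechet_derivative_works)
  from partial_eqI[OF this]
  have p: "partial b (\<lambda>x. inverse (f x)) = (\<lambda>x. (- 1) *\<^sub>R (inverse (f x) *\<^sub>R (partial b f x *\<^sub>R inverse (f x))))" for b
    by (simp add: fun_eq_iff algebra_simps)
  have I: "diff_upto n (\<lambda>x. inverse (f x))" using Suc diff_upto_SucD by blast
  have "b \<in> Basis \<Longrightarrow> diff_upto n (partial b (\<lambda>x. inverse (f x)))" for b
    unfolding p using I Suc.prems by (intro diff_upto_scaleR diff_upto_const) auto
  moreover have "(\<lambda>x. inverse (f x)) differentiable_on UNIV"
    using d nz by (auto simp: differentiable_on_def intro!: differentiable_inverse)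
  ultimately show ?case by simp
qed

lemma diff_upto_sqrt:
  fixes f :: "'a::euclidean_space \<Rightarrow> real"
  assumes pos: "\<And>x. f x > 0"
  shows "diff_upto n f \<Longrightarrow> diff_upto n (\<lambda>x. sqrt (f x))"
proof (induction n)
  have D: "((\<lambda>x. sqrt (f x)) has_derivative
      (\<lambda>h. frechet_derivative f (at x) h * (inverse (sqrt (f x)) / 2))) (at x)"
    if "\<And>x. f differentiable (at x)" for x
    using that pos
    by (intro has_derivative_compose[where f = f and g = sqrt, unfolded o_def]
        DERIV_real_sqrt[THEN has_field_derivative_imp_has_derivative, THEN has_derivative_eq_rhs])
      (auto simp: frechet_derivative_works)
  {
    case 0
    then show ?case using D by (force simp: differentiable_on_def differentiable_def)
  next
    case (Suc n)
    note d = diff_upto_imp_differentiable[OF Suc.prems]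
    \<comment> \<open>Trading \<open>inverse (sqrt f)\<close> for \<open>inverse f * sqrt f\<close>
      lets \<open>sqrt f\<close> reappear in its own derivative, accompanied only by functions
      already under control, so that the induction closes.\<close>
    have *: "inverse (sqrt (f x)) = inverse (f x) * sqrt (f x)" for x
      using pos[of x] by (simp add: field_simps)
    have p: "partial b (\<lambda>x. sqrt (f x)) =
        (\<lambda>x. (1/2) *\<^sub>R (partial b f x *\<^sub>R (inverse (f x) *\<^sub>R sqrt (f x))))" for b
      using partial_eqI[OF D[OF d]] by (simp add: fun_eq_iff *)
    have I: "diff_upto n (\<lambda>x. sqrt (f x))" "diff_upto n (\<lambda>x. inverse (f x))"
      using Suc diff_upto_SucD pos by (auto intro!: diff_upto_inverse simp: less_imp_neq[symmetric])
    have "b \<in> Basis \<Longrightarrow> diff_upto n (partial b (\<lambda>x. sqrt (f x)))" for b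
      unfolding p using I Suc.prems by (intro diff_upto_scaleR diff_upto_const) auto
    moreover have "(\<lambda>x. sqrt (f x)) differentiable_on UNIV"
      using D[OF d] by (auto simp: differentiable_on_def differentiable_def)
    ultimately show ?case by simp
  }
qed

lemma smooth_fun_sqrt:
  fixes f :: "'a::euclidean_space \<Rightarrow> real"
  shows "smooth_fun f \<Longrightarrow> (\<And>x. f x > 0) \<Longrightarrow> smooth_fun (\<lambda>x. sqrt (f x))"
  by (simp add: smooth_fun_iff_diff_upto diff_upto_sqrt)

section \<open>Bounds on finitely many derivatives\<close>

text \<open>This is the premise of the norm estimate in \<open>torus_distribution\<close>, isolated
  so that it can be unfolded one derivative at a time.\<close>

definition bound_upto :: "nat \<Rightarrow> real \<Rightarrow> ('a::euclidean_space \<Rightarrow> 'b::real_normed_vector) \<Rightarrow> bool" where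
  "bound_upto m B f \<longleftrightarrow>
     (\<forall>bs\<in>lists Basis. length bs \<le> m \<longrightarrow> (\<forall>x. norm (iter_partial bs f x) \<le> B))"

lemma bound_upto_0: "bound_upto 0 B f \<longleftrightarrow> (\<forall>x. norm (f x) \<le> B)"
  unfolding bound_upto_def by simp

lemma bound_upto_Suc: "bound_upto (Suc m) B f \<longleftrightarrow>
    (\<forall>x. norm (f x) \<le> B) \<and> (\<forall>b\<in>Basis. bound_upto m B (partial b f))"
  unfolding bound_upto_def all_lists_upto_Suc_iff iter_partial_snoc by simp

lemma bound_upto_SucD: "bound_upto (Suc m) B f \<Longrightarrow> bound_upto m B f"
  unfolding bound_upto_def by simp

lemma bound_upto_mono: "bound_upto m B f \<Longrightarrow> B \<le> B' \<Longrightarrow> bound_upto m B' f"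
  unfolding bound_upto_def by (meson order_trans)

lemma bound_upto_norm: "bound_upto m B f \<Longrightarrow> norm (f x) \<le> B"
  by (cases m) (auto simp: bound_upto_0 bound_upto_Suc)

lemma bound_upto_nonneg: "bound_upto m B f \<Longrightarrow> 0 \<le> B"
  using bound_upto_norm[of m B f 0] norm_ge_zero order_trans by blast

lemma bound_upto_add:
  "smooth_fun f \<Longrightarrow> smooth_fun g \<Longrightarrow> bound_upto m B f \<Longrightarrow> bound_upto m C g \<Longrightarrow>
    bound_upto m (B + C) (\<lambda>x. f x + g x)"
proof (induction m arbitrary: f g)
  case 0
  then show ?case by (auto simp: bound_upto_0 intro!: norm_triangle_mono)
next
  case (Suc m)
  note d = Suc.prems(1,2)[THEN smooth_fun_differentiable]
  show ?case using Suc
    by (auto simp: bound_upto_Suc partial_add[OF d] smooth_fun_partial intro!: norm_triangle_mono)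
qed

text \<open>Leibniz rule with a constant uniform in \<open>g\<close> and \<open>B\<close>:
  multiplication by \<open>a\<close> is continuous in the \<open>m\<close>-th norm, so multiplying a
  distribution by \<open>sqrt c\<close> keeps its order.\<close>

lemma bound_upto_scaleR:
  fixes a :: "'a::euclidean_space \<Rightarrow> real"
  assumes "smooth_fun a" "\<And>bs. bs \<in> lists Basis \<Longrightarrow> bounded (range (iter_partial bs a))"
  shows "\<exists>D\<ge>0. \<forall>B. \<forall>g :: 'a \<Rightarrow> 'b::real_normed_vector. smooth_fun g \<longrightarrow> bound_upto m B g \<longrightarrow>
           bound_upto m (D * B) (\<lambda>x. a x *\<^sub>R g x)"
  using assms
proof (induction m arbitrary: a)
  case 0
  then obtain D where "\<And>x. norm (a x) \<le> D" using 0(2)[of "[]"] by (auto simp: bounded_iff)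
  then show ?case
    by (intro exI[of _ "max 0 D"]) (auto simp: bound_upto_0 intro!: mult_mono intro: le_max_iff_disj[THEN iffD2])
next
  case (Suc m)
  obtain D0 where D0: "\<And>x. norm (a x) \<le> D0" using Suc.prems(2)[of "[]"] by (auto simp: bounded_iff)
  then have "0 \<le> D0" using norm_ge_zero order_trans by blast
  obtain D1 where D1: "D1 \<ge> 0"
    "\<And>B. \<And>g :: 'a \<Rightarrow> 'b. smooth_fun g \<Longrightarrow> bound_upto m B g \<Longrightarrow> bound_upto m (D1 * B) (\<lambda>x. a x *\<^sub>R g x)"
    using Suc by metis
  have "\<exists>D\<ge>0. \<forall>B. \<forall>g :: 'a \<Rightarrow> 'b. smooth_fun g \<longrightarrow> bound_upto m B g \<longrightarrow>
           bound_upto m (D * B) (\<lambda>x. partial b a x *\<^sub>R g x)" if "b \<in> Basis" for b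
  proof (rule Suc.IH)
    show "bounded (range (iter_partial bs (partial b a)))" if "bs \<in> lists Basis" for bs
      using Suc.prems(2)[of "bs @ [b]"] \<open>b \<in> Basis\<close> that by (simp add: iter_partial_snoc)
  qed (use Suc.prems that smooth_fun_partial in blast)
  then obtain D2 where D2: "\<And>b. b \<in> Basis \<Longrightarrow> D2 b \<ge> 0"
     "\<And>b B. \<And>g :: 'a \<Rightarrow> 'b. b \<in> Basis \<Longrightarrow> smooth_fun g \<Longrightarrow> bound_upto m B g \<Longrightarrow>
        bound_upto m (D2 b * B) (\<lambda>x. partial b a x *\<^sub>R g x)" by metis
  \<comment> \<open>\<open>D0\<close> bounds the values, \<open>D1\<close> handles the terms in
    which \<open>g\<close> is differentiated and \<open>D2 b\<close> those in which \<open>a\<close>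
    is. Summing over the basis makes one constant serve every direction \<open>b\<close>.\<close>
  define D where "D = D0 + D1 + sum D2 Basis"
  have S: "0 \<le> sum D2 Basis" "b \<in> Basis \<Longrightarrow> D2 b \<le> sum D2 Basis" for b
    using D2(1) by (auto intro: sum_nonneg member_le_sum)
  have "bound_upto (Suc m) (D * B) (\<lambda>x. a x *\<^sub>R g x)"
    if g: "smooth_fun g" "bound_upto (Suc m) B g" for B and g :: "'a \<Rightarrow> 'b"
  proof -
    have B: "0 \<le> B" using bound_upto_nonneg that by blast
    have "norm (a x *\<^sub>R g x) \<le> D * B" for x
    proof -
      have "norm (a x *\<^sub>R g x) \<le> D0 * B" unfolding norm_scaleR
        using D0 bound_upto_norm[OF g(2)] \<open>0 \<le> D0\<close> by (intro mult_mono) auto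
      also have "\<dots> \<le> D * B" using B D1(1) S(1) unfolding D_def by (intro mult_right_mono) auto
      finally show ?thesis .
    qed
    moreover have "bound_upto m (D * B) (partial b (\<lambda>x. a x *\<^sub>R g x))" if b: "b \<in> Basis" for b
    proof -
      note d = Suc.prems(1)[THEN smooth_fun_differentiable] g(1)[THEN smooth_fun_differentiable]
      have "bound_upto m (D2 b * B + D1 * B) (\<lambda>x. partial b a x *\<^sub>R g x + a x *\<^sub>R partial b g x)"
      proof (rule bound_upto_add)
        show "bound_upto m (D2 b * B) (\<lambda>x. partial b a x *\<^sub>R g x)"
          using D2(2)[OF b g(1)] bound_upto_SucD[OF g(2)] by blast
        show "bound_upto m (D1 * B) (\<lambda>x. a x *\<^sub>R partial b g x)"
          using D1(2) smooth_fun_partial[OF g(1) b] g(2) b unfolding bound_upto_Suc by blast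
      qed (use g b Suc.prems(1) in \<open>auto intro: smooth_fun_scaleR smooth_fun_partial\<close>)
      moreover have "D2 b * B + D1 * B \<le> D * B"
        unfolding D_def distrib_right[symmetric] using B S(2)[OF b] \<open>0 \<le> D0\<close>
        by (intro mult_right_mono) auto
      ultimately show ?thesis unfolding partial_scaleR[OF d] using bound_upto_mono by blast
    qed
    ultimately show ?thesis unfolding bound_upto_Suc by blast
  qed
  moreover have "0 \<le> D" using \<open>0 \<le> D0\<close> D1(1) S(1) by (simp add: D_def)
  ultimately show ?case by blast
qed

section \<open>Differentiation under an averaging integral\<close>

text \<open>Common form of convolutions (\<open>L\<close> is a reflection) and of averages along
  lines (\<open>L\<close> runs through multiples of a direction), so that one differentiation under
  the integral covers both.\<close>

definition average :: "'a::euclidean_space \<Rightarrow> 'a \<Rightarrow> ('a \<Rightarrow> real) \<Rightarrow> ('a \<Rightarrow> 'c) \<Rightarrow>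
    ('c::euclidean_space \<Rightarrow> 'b::banach) \<Rightarrow> 'c \<Rightarrow> 'b" where
  "average p q k L f x = integral (cbox p q) (\<lambda>y. k y *\<^sub>R f (x + L y))"

lemma average_integrable:
  fixes f :: "'c::euclidean_space \<Rightarrow> 'b::banach"
  assumes "continuous_on (cbox p q) k" "continuous_on UNIV L" "continuous_on UNIV f"
  shows "(\<lambda>y. k y *\<^sub>R f (x + L y)) integrable_on cbox p q"
  using assms
  by (intro integrable_continuous continuous_intros continuous_on_compose2[OF assms(3)]
      continuous_on_subset[OF assms(2)]) auto

text \<open>The Leibniz rule asks for a derivative that is continuous as a bounded linear map. In
  finite dimension this follows from its values on the basis, which are smooth, hence continuous,
  partial derivatives. Evaluation at \<open>b\<close> then commutes with the integral.\<close>

lemma average_has_partial: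
  fixes f :: "'c::euclidean_space \<Rightarrow> 'b::banach"
  assumes k: "continuous_on (cbox p q) k" and L: "continuous_on UNIV L" and f: "smooth_fun f"
  shows "average p q k L f differentiable (at x)"
    and "b \<in> Basis \<Longrightarrow> partial b (average p q k L f) = average p q k L (partial b f)"
proof -
  define D where "D x = Blinfun (frechet_derivative f (at x))" for x
  note fd = smooth_fun_differentiable[OF f, unfolded frechet_derivative_works]
  have D: "blinfun_apply (D x) = frechet_derivative f (at x)" for x
    unfolding D_def using fd by (intro bounded_linear_Blinfun_apply has_derivative_bounded_linear)
  have contD: "continuous_on UNIV D"
    by (rule continuous_on_blinfun_componentwise)
       (use smooth_fun_partial[OF f] in \<open>auto simp: D intro: smooth_fun_continuous_on\<close>)
  define G where "G x y = k y *\<^sub>R D (x + L y)" for x y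
  have G: "((\<lambda>x. k y *\<^sub>R f (x + L y)) has_derivative blinfun_apply (G x y)) (at x)" for x y
  proof -
    have "((\<lambda>x. f (x + L y)) has_derivative (\<lambda>h. frechet_derivative f (at (x + L y)) h)) (at x)"
      by (rule has_derivative_compose[OF _ fd, where f = "\<lambda>x. x + L y" and f' = "\<lambda>h. h", unfolded o_def])
         (auto intro!: derivative_eq_intros)
    then have "((\<lambda>x. k y *\<^sub>R f (x + L y)) has_derivative
        (\<lambda>h. k y *\<^sub>R frechet_derivative f (at (x + L y)) h)) (at x)"
      by (rule has_derivative_scaleR_right)
    then show ?thesis by (simp add: G_def D scaleR_blinfun.rep_eq)
  qed
  have contG: "continuous_on (UNIV \<times> cbox p q) (\<lambda>(x, y). G x y)"
    unfolding G_def split_def using k L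
    by (intro continuous_intros continuous_on_compose2[OF contD] continuous_on_compose2[OF k]
        continuous_on_compose2[OF L]) auto
  have A: "(average p q k L f has_derivative integral (cbox p q) (G x)) (at x)" for x
    unfolding average_def
    using leibniz_rule[where U = UNIV and f = "\<lambda>x y. k y *\<^sub>R f (x + L y)" and fx = G and ?x0.0 = x
        and a = p and b = q]
      G average_integrable[OF k L smooth_fun_continuous_on[OF f]] contG by auto
  then show "average p q k L f differentiable (at x)"
    unfolding differentiable_def by blast
  show "partial b (average p q k L f) = average p q k L (partial b f)" if "b \<in> Basis"
  proof
    fix x
    have "G x integrable_on cbox p q"
    proof (rule integrable_continuous)
      have "continuous_on (cbox p q) (\<lambda>y. (\<lambda>(x, y). G x y) (x, y))"
        by (rule continuous_on_compose2[OF contG]) (auto intro!: continuous_intros)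
      then show "continuous_on (cbox p q) (G x)" by simp
    qed
    then have "integral (cbox p q) ((\<lambda>h. blinfun_apply h b) \<circ> G x) = integral (cbox p q) (G x) b"
      by (rule integral_linear) (rule bounded_linear_intros)+
    then show "partial b (average p q k L f) x = average p q k L (partial b f) x"
      unfolding partial_eqI[OF A] by (simp add: average_def G_def D o_def scaleR_blinfun.rep_eq)
  qed
qed

lemma smooth_fun_average:
  fixes f :: "'c::euclidean_space \<Rightarrow> 'b::banach"
  assumes k: "continuous_on (cbox p q) k" and L: "continuous_on UNIV L" and f: "smooth_fun f"
  shows "smooth_fun (average p q k L f)"
proof (rule smooth_fun_coinduct[where P = "\<lambda>h. \<exists>g. h = average p q k L g \<and> smooth_fun g"])
  fix h :: "'c \<Rightarrow> 'b" and x b :: 'c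
  assume "\<exists>g. h = average p q k L g \<and> smooth_fun g"
  then obtain g where h: "h = average p q k L g" and g: "smooth_fun g" by blast
  show "h differentiable (at x)" unfolding h by (rule average_has_partial[OF k L g])
  assume "b \<in> Basis"
  then show "\<exists>g. partial b h = average p q k L g \<and> smooth_fun g"
    unfolding h using average_has_partial(2)[OF k L g] smooth_fun_partial[OF g] by blast
qed (use f in auto)

lemma iter_partial_average:
  fixes f :: "'c::euclidean_space \<Rightarrow> 'b::banach"
  assumes k: "continuous_on (cbox p q) k" and L: "continuous_on UNIV L" and f: "smooth_fun f"
  shows "bs \<in> lists Basis \<Longrightarrow>
    iter_partial bs (average p q k L f) = average p q k L (iter_partial bs f)"
proof (induction bs)
  case (Cons b bs)
  then show ?case
    using average_has_partial(2)[OF k L smooth_fun_iter_partial[OF f, of bs], of b] by simp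
qed simp


section \<open>Trigonometric approximation on the torus\<close>

text \<open>The Fourier analysis is done in an arbitrary Euclidean space;
  \<open>int_lattice_eq_range\<close> later identifies this lattice with the integer vectors of
  spacetime.\<close>

definition int_lattice :: "'a::euclidean_space set" where
  "int_lattice = {z. \<forall>b\<in>Basis. z \<bullet> b \<in> \<int>}"

definition lattice_periodic :: "('a::euclidean_space \<Rightarrow> 'b) \<Rightarrow> bool" where
  "lattice_periodic f \<longleftrightarrow> (\<forall>x. \<forall>z\<in>int_lattice. f (x + z) = f x)"

lemma int_lattice_add: "z \<in> int_lattice \<Longrightarrow> w \<in> int_lattice \<Longrightarrow> z + w \<in> int_lattice"
  by (auto simp: int_lattice_def inner_add_left)

lemma int_lattice_uminus: "z \<in> int_lattice \<Longrightarrow> - z \<in> int_lattice"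
  by (auto simp: int_lattice_def)

lemma zero_in_int_lattice: "0 \<in> int_lattice"
  by (auto simp: int_lattice_def)

lemma Basis_subset_int_lattice: "b \<in> Basis \<Longrightarrow> b \<in> int_lattice"
  by (auto simp: int_lattice_def inner_Basis)

lemma inner_int_lattice: "z \<in> int_lattice \<Longrightarrow> w \<in> int_lattice \<Longrightarrow> z \<bullet> w \<in> \<int>"
  unfolding euclidean_inner[of z w] by (auto simp: int_lattice_def intro!: Ints_sum)

lemma lattice_periodicD: "lattice_periodic f \<Longrightarrow> z \<in> int_lattice \<Longrightarrow> f (x + z) = f x"
  by (simp add: lattice_periodic_def)

lemma exists_lattice_translate:
  obtains z where "z \<in> int_lattice" "\<forall>b\<in>Basis. 0 \<le> (x + z) \<bullet> b \<and> (x + z) \<bullet> b \<le> 1"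
proof
  define z where "z = (\<Sum>b\<in>Basis. (- of_int \<lfloor>x \<bullet> b\<rfloor>) *\<^sub>R b)"
  have z: "z \<bullet> b = - of_int \<lfloor>x \<bullet> b\<rfloor>" if "b \<in> Basis" for b
    unfolding z_def using that by (rule inner_sum_left_Basis)
  show "z \<in> int_lattice" by (auto simp: int_lattice_def z)
  show "\<forall>b\<in>Basis. 0 \<le> (x + z) \<bullet> b \<and> (x + z) \<bullet> b \<le> 1"
    by (auto simp: inner_add_left z) linarith+
qed

lemma norm_le_DIM_times:
  fixes x :: "'a::euclidean_space" and r :: real
  assumes "\<forall>b\<in>Basis. \<bar>x \<bullet> b\<bar> \<le> (r::real)"
  shows "norm x \<le> DIM('a) * r"
proof -
  have "norm x \<le> (\<Sum>b\<in>Basis. \<bar>x \<bullet> b\<bar>)" by (rule norm_le_l1)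
  also have "\<dots> \<le> (\<Sum>b\<in>(Basis :: 'a set). r)" using assms by (intro sum_mono) auto
  finally show ?thesis by simp
qed

lemma lattice_periodic_bounded:
  fixes f :: "'a::euclidean_space \<Rightarrow> 'b::real_normed_vector"
  assumes "lattice_periodic f" "continuous_on UNIV f"
  shows "bounded (range f)"
proof -
  have "range f \<subseteq> f ` cball 0 (real DIM('a))"
  proof safe
    fix x :: 'a
    obtain z where z: "z \<in> int_lattice" "\<forall>b\<in>Basis. 0 \<le> (x + z) \<bullet> b \<and> (x + z) \<bullet> b \<le> 1"
      by (rule exists_lattice_translate)
    then have "norm (x + z) \<le> DIM('a)" using norm_le_DIM_times[of "x + z" 1] by auto
    then show "f x \<in> f ` cball 0 (real DIM('a))"
      using lattice_periodicD[OF assms(1) z(1), of x] by (metis imageI mem_cball_0)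
  qed
  moreover have "compact (f ` cball 0 (real DIM('a)))"
    using assms(2) by (intro compact_continuous_image) (auto intro: continuous_on_subset)
  ultimately show ?thesis using compact_imp_bounded bounded_subset by blast
qed

lemma lattice_periodic_uniformly_continuous:
  fixes f :: "'a::euclidean_space \<Rightarrow> 'b::real_normed_vector"
  assumes "lattice_periodic f" "continuous_on UNIV f" "\<epsilon> > 0"
  obtains \<delta> where "\<delta> > 0" "\<And>x y. norm y < \<delta> \<Longrightarrow> norm (f (x + y) - f x) < \<epsilon>"
proof -
  \<comment> \<open>Points of the unit cube have norm at most the dimension; the additional 1 leaves
    room for a displacement \<open>y\<close> of norm less than 1.\<close>
  define C where "C = cball (0::'a) (real DIM('a) + 1)"
  have "uniformly_continuous_on C f"
    using assms(2) unfolding C_def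
    by (intro compact_uniformly_continuous) (auto intro: continuous_on_subset)
  then obtain d where d: "d > 0" "\<And>x x'. x \<in> C \<Longrightarrow> x' \<in> C \<Longrightarrow> dist x' x < d \<Longrightarrow> dist (f x') (f x) < \<epsilon>"
    unfolding uniformly_continuous_on_def using assms(3) by metis
  show ?thesis
  proof (rule that[of "min d 1"])
    fix x y :: 'a
    assume y: "norm y < min d 1"
    obtain z where z: "z \<in> int_lattice" "\<forall>b\<in>Basis. 0 \<le> (x + z) \<bullet> b \<and> (x + z) \<bullet> b \<le> 1"
      by (rule exists_lattice_translate)
    then have "norm (x + z) \<le> DIM('a)" using norm_le_DIM_times[of "x + z" 1] by auto
    then have "x + z \<in> C" "x + z + y \<in> C" unfolding C_def
      using y norm_triangle_ineq[of "x + z" y] by auto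
    then have "dist (f (x + z + y)) (f (x + z)) < \<epsilon>" using d(2) y by (simp add: dist_norm)
    moreover have "f (x + z + y) = f (x + y)"
      using lattice_periodicD[OF assms(1) z(1), of "x + y"] by (simp add: algebra_simps)
    ultimately show "norm (f (x + y) - f x) < \<epsilon>"
      using lattice_periodicD[OF assms(1) z(1), of x] by (simp add: dist_norm)
  qed (use d in auto)
qed

text \<open>The box of edges \<open>1\<close> and \<open>1 + r\<close> is cut in two ways into a unit cube and a slab; the two
  slabs differ by a lattice vector.\<close>

lemma integral_unit_cube_shift_Basis:
  fixes f :: "'a::euclidean_space \<Rightarrow> 'b::banach"
  assumes f: "lattice_periodic f" "continuous_on UNIV f" and b: "b \<in> Basis" and r: "0 \<le> r" "r \<le> 1"
  shows "integral (cbox (p + r *\<^sub>R b) (p + r *\<^sub>R b + One)) f = integral (cbox p (p + One)) f"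
proof -
  define D where "D = cbox p (p + One + r *\<^sub>R b)"
  have int: "f integrable_on cbox u v" for u v
    using f(2) by (intro integrable_continuous) (auto intro: continuous_on_subset)
  have in_b: "(b \<bullet> i :: real) = (if i = b then 1 else 0)" if "i \<in> Basis" for i
    using that b by (simp add: inner_Basis)
  have s: "D \<inter> {x. x \<bullet> b \<le> p \<bullet> b + 1} = cbox p (p + One)"
    "D \<inter> {x. x \<bullet> b \<ge> p \<bullet> b + 1} = cbox (p + b) (p + One + r *\<^sub>R b)"
    "D \<inter> {x. x \<bullet> b \<le> p \<bullet> b + r} = cbox p (p + One - b + r *\<^sub>R b)"
    "D \<inter> {x. x \<bullet> b \<ge> p \<bullet> b + r} = cbox (p + r *\<^sub>R b) (p + One + r *\<^sub>R b)"
    unfolding D_def using b r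
    by (auto simp: mem_box inner_add_left inner_diff_left in_b split: if_splits;
        (fastforce | smt (verit)))+
  have "integral (cbox (p + b) (p + One + r *\<^sub>R b)) f = integral (cbox p (p + One - b + r *\<^sub>R b)) f"
  proof -
    have "f \<circ> (+) b = f"
      using lattice_periodicD[OF f(1) Basis_subset_int_lattice[OF b]] by (simp add: fun_eq_iff add.commute)
    moreover have "p + One - b + r *\<^sub>R b + b = p + One + r *\<^sub>R b" by simp
    ultimately show ?thesis
      using integral_shift_cbox_plus[of p "p + One - b + r *\<^sub>R b" f b] by metis
  qed
  moreover have "integral (cbox p (p + One)) f + integral (cbox (p + b) (p + One + r *\<^sub>R b)) f
      = integral D f"
    using integral_split[OF int b, of p "p + One + r *\<^sub>R b" "p \<bullet> b + 1"] s by (simp add: D_def)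
  moreover have "integral (cbox p (p + One - b + r *\<^sub>R b)) f +
      integral (cbox (p + r *\<^sub>R b) (p + One + r *\<^sub>R b)) f = integral D f"
    using integral_split[OF int b, of p "p + One + r *\<^sub>R b" "p \<bullet> b + r"] s by (simp add: D_def)
  ultimately have "integral (cbox (p + r *\<^sub>R b) (p + One + r *\<^sub>R b)) f = integral (cbox p (p + One)) f"
    by (metis add.commute add_left_cancel)
  then show ?thesis by (simp add: add_ac)
qed

text \<open>Shifts of length at most 1 along an axis compose to shifts of any length, negative ones
  being undone by positive ones, and axis by axis to any translation.\<close>

lemma integral_unit_cube:
  fixes f :: "'a::euclidean_space \<Rightarrow> 'b::banach"
  assumes f: "lattice_periodic f" "continuous_on UNIV f"
  shows "integral (cbox p (p + One)) f = integral (cbox q (q + One)) f"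
proof -
  define I where "I p = integral (cbox p (p + One)) f" for p
  have nonneg: "I (p + (real n * r) *\<^sub>R b) = I p" if "b \<in> Basis" "0 \<le> r" "r \<le> 1" for n r b p
  proof (induction n)
    case (Suc n)
    then show ?case
      using integral_unit_cube_shift_Basis[OF f that, of "p + (real n * r) *\<^sub>R b"]
      by (simp add: I_def algebra_simps)
  qed simp
  have pos: "I (p + r *\<^sub>R b) = I p" if "b \<in> Basis" "0 \<le> r" for r b p
  proof -
    obtain n :: nat where n: "r < real n" using reals_Archimedean2 by blast
    then have "real n * (r / real n) = r" "r / real n \<le> 1" "0 \<le> r / real n" using that by auto
    then show ?thesis using nonneg[of b "r / real n" p n] that by metis
  qed
  have any: "I (p + r *\<^sub>R b) = I p" if "b \<in> Basis" for r b p
    using pos[OF that, of r p] pos[OF that, of "- r" "p + r *\<^sub>R b"] by (cases "r \<ge> 0") auto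
  have "I (p + (\<Sum>b\<in>B. r b *\<^sub>R b)) = I p" if "finite B" "B \<subseteq> Basis" for B r p
    using that
  proof (induction B)
    case (insert b B)
    then show ?case using any[of b "p + (\<Sum>b\<in>B. r b *\<^sub>R b)" "r b"] by (simp add: algebra_simps)
  qed simp
  from this[of Basis p "\<lambda>b. (q - p) \<bullet> b"] have "I (p + (q - p)) = I p"
    unfolding euclidean_representation by simp
  then show ?thesis by (simp add: I_def)
qed

section \<open>Characters and trigonometric polynomials\<close>

definition character :: "'a::euclidean_space \<Rightarrow> 'a \<Rightarrow> complex" where
  "character k x = exp (2 * of_real pi * \<i> * of_real (k \<bullet> x))"

lemma character_cis: "character k x = cis (2 * pi * (k \<bullet> x))"
  by (simp add: character_def cis_conv_exp algebra_simps)

lemma character_add_right: "character k (x + y) = character k x * character k y"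
  by (simp add: character_cis cis_mult inner_add_right algebra_simps)

lemma character_add_left: "character (k + l) x = character k x * character l x"
  by (simp add: character_cis cis_mult inner_add_left algebra_simps)

lemma cnj_character: "cnj (character k x) = character (- k) x"
  by (simp add: character_cis cis_cnj)

lemma character_diff_right: "character k (x - y) = character k x * cnj (character k y)"
  by (simp add: character_cis cis_cnj cis_mult inner_diff_right algebra_simps)

lemma character_mult_cnj: "character k x * cnj (character k x) = 1"
  by (simp add: character_cis cis_cnj cis_mult)

lemma character_zero: "character 0 x = 1"
  by (simp add: character_def)

lemma character_eq_1: "k \<bullet> x \<in> \<int> \<Longrightarrow> character k x = 1"
  by (auto simp: character_cis elim!: Ints_cases)

lemma lattice_periodic_character: "k \<in> int_lattice \<Longrightarrow> lattice_periodic (character k)"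
  by (simp add: lattice_periodic_def character_add_right character_eq_1 inner_int_lattice)

lemma continuous_on_character [continuous_intros]:
  "continuous_on S f \<Longrightarrow> continuous_on S (\<lambda>x. character k (f x))"
  unfolding character_def by (intro continuous_intros)

lemma character_has_derivative:
  "(character k has_derivative (\<lambda>h. (2 * of_real pi * \<i> * of_real (k \<bullet> h)) * character k x)) (at x)"
proof -
  have "((\<lambda>x. 2 * of_real pi * \<i> * of_real (k \<bullet> x) :: complex) has_derivative
      (\<lambda>h. 2 * of_real pi * \<i> * of_real (k \<bullet> h))) (at x)"
    by (auto intro!: derivative_eq_intros)
  from has_derivative_compose[OF this, of exp "(*) (character k x)"]
  show ?thesis
    using DERIV_exp[of "2 * of_real pi * \<i> * of_real (k \<bullet> x)"]
    by (simp add: character_def[abs_def] o_def has_field_derivative_def mult.commute)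
qed

lemma smooth_fun_character: "smooth_fun (\<lambda>x. a * character k x)"
proof (rule smooth_fun_coinduct[where P = "\<lambda>f. \<exists>a. f = (\<lambda>x. a * character k x)"])
  fix f and x b :: 'a
  assume "\<exists>a. f = (\<lambda>x. a * character k x)"
  then obtain a where f: "f = (\<lambda>x. a * character k x)" by blast
  note D = has_derivative_mult_right[OF character_has_derivative, of a k]
  show "f differentiable (at x)" unfolding f using D differentiable_def by blast
  show "\<exists>a. partial b f = (\<lambda>x. a * character k x)"
    unfolding f partial_eqI[OF D] by (intro exI[of _ "a * (2 * of_real pi * \<i> * of_real (k \<bullet> b))"]) auto
qed auto

definition fcoeff :: "('a::euclidean_space \<Rightarrow> complex) \<Rightarrow> 'a \<Rightarrow> complex" where
  "fcoeff f k = integral (cbox 0 One) (\<lambda>x. f x * cnj (character k x))"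

text \<open>The parameter \<Lambda> tracks the spectrum: convolution cuts it down to the nonzero
  coefficients of a function, averaging to a hyperplane, and over the empty spectrum only the zero
  function is left.\<close>

inductive trig_poly :: "'a::euclidean_space set \<Rightarrow> ('a \<Rightarrow> complex) \<Rightarrow> bool" for \<Lambda> where
  trig_poly_zero: "trig_poly \<Lambda> (\<lambda>x. 0)"
| trig_poly_insert: "k \<in> \<Lambda> \<Longrightarrow> trig_poly \<Lambda> g \<Longrightarrow> trig_poly \<Lambda> (\<lambda>x. a * character k x + g x)"

lemma trig_poly_smooth: "trig_poly \<Lambda> g \<Longrightarrow> smooth_fun g"
proof (induction rule: trig_poly.induct)
  case trig_poly_zero
  then show ?case using smooth_fun_character[of 0] by simp
next
  case (trig_poly_insert k g a)
  then show ?case by (intro smooth_fun_add smooth_fun_character)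
qed

lemma trig_poly_periodic: "trig_poly \<Lambda> g \<Longrightarrow> \<Lambda> \<subseteq> int_lattice \<Longrightarrow> lattice_periodic g"
proof (induction rule: trig_poly.induct)
  case (trig_poly_insert k g a)
  then show ?case using lattice_periodic_character[of k] by (auto simp: lattice_periodic_def)
qed (simp add: lattice_periodic_def)

lemma trig_poly_character: "k \<in> \<Lambda> \<Longrightarrow> trig_poly \<Lambda> (\<lambda>x. a * character k x)"
  using trig_poly_insert[OF _ trig_poly_zero, of k \<Lambda> a] by simp

lemma trig_poly_add: "trig_poly \<Lambda> f \<Longrightarrow> trig_poly \<Lambda> g \<Longrightarrow> trig_poly \<Lambda> (\<lambda>x. f x + g x)"
proof (induction rule: trig_poly.induct)
  case (trig_poly_insert k f a)
  then show ?case using trig_poly.trig_poly_insert[of k \<Lambda> "\<lambda>x. f x + g x" a]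
    by (simp add: add.assoc)
qed simp

lemma trig_poly_character_mult:
  assumes "trig_poly int_lattice g" "k \<in> int_lattice"
  shows "trig_poly int_lattice (\<lambda>x. a * character k x * g x)"
  using assms(1)
proof (induction rule: trig_poly.induct)
  case trig_poly_zero
  then show ?case using trig_poly.trig_poly_zero by simp
next
  case (trig_poly_insert l g c)
  then show ?case
    using trig_poly.trig_poly_insert[of "k + l" int_lattice "\<lambda>x. a * character k x * g x" "a * c"]
      assms(2) by (simp add: int_lattice_add character_add_left algebra_simps)
qed

lemma trig_poly_mult:
  "trig_poly int_lattice f \<Longrightarrow> trig_poly int_lattice g \<Longrightarrow> trig_poly int_lattice (\<lambda>x. f x * g x)"
proof (induction rule: trig_poly.induct)
  case (trig_poly_insert k f a)
  then show ?case by (auto simp: distrib_right intro!: trig_poly_add trig_poly_character_mult)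
qed (simp add: trig_poly_zero)

lemma trig_poly_const: "trig_poly int_lattice (\<lambda>x. a)"
  using trig_poly_character[OF zero_in_int_lattice, of a] by (simp add: character_zero)

lemma trig_poly_power: "trig_poly int_lattice f \<Longrightarrow> trig_poly int_lattice (\<lambda>x. f x ^ n)"
  by (induction n) (auto intro: trig_poly_const trig_poly_mult)

lemma trig_poly_sum:
  "(\<And>i. i \<in> I \<Longrightarrow> trig_poly \<Lambda> (f i)) \<Longrightarrow> trig_poly \<Lambda> (\<lambda>x. \<Sum>i\<in>I. f i x)"
  by (induction I rule: infinite_finite_induct) (auto intro: trig_poly_add trig_poly_zero)

section \<open>Positive trigonometric kernels\<close>

text \<open>The cube of integration is centred so that the origin is its only lattice point, the one
  near which a periodic kernel has to concentrate.\<close>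

definition convolve :: "('a::euclidean_space \<Rightarrow> real) \<Rightarrow> ('a \<Rightarrow> 'b::banach) \<Rightarrow> 'a \<Rightarrow> 'b" where
  "convolve P f = average (- ((1/2) *\<^sub>R One)) ((1/2) *\<^sub>R One) P uminus f"

lemma half_One: "(1/2) *\<^sub>R (One :: 'a::euclidean_space) = - ((1/2) *\<^sub>R One) + One"
proof -
  have "(1/2) *\<^sub>R (One :: 'a) + (1/2) *\<^sub>R One = One" by (simp flip: scaleR_add_left)
  then show ?thesis by (metis add.assoc add.left_inverse add_0)
qed

lemma content_centred_cube:
  "measure lborel (cbox (- ((1/2) *\<^sub>R One)) ((1/2) *\<^sub>R One :: 'a::euclidean_space)) = 1"
  by (subst content_cbox') (auto simp: box_ne_empty)

lemma lattice_periodic_mult: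
  "lattice_periodic f \<Longrightarrow> lattice_periodic g \<Longrightarrow> lattice_periodic (\<lambda>x. f x * g x)"
  by (simp add: lattice_periodic_def)

text \<open>Writing \<open>y = x - (x - y)\<close> splits off the factor
  \<open>character k x\<close>. What remains is a periodic function of \<open>x - y\<close>, whose
  integral ignores the reflection and the translation of the cube.\<close>

lemma integral_character_mult_shift:
  assumes f: "lattice_periodic f" "continuous_on UNIV f" and k: "k \<in> int_lattice"
  shows "integral (cbox (- ((1/2) *\<^sub>R One)) ((1/2) *\<^sub>R One)) (\<lambda>y. character k y * f (x - y))
    = fcoeff f k * character k x"
proof -
  define H where "H = ((1/2) *\<^sub>R One :: 'a)"
  define G where "G = (\<lambda>z. f z * cnj (character k z))"
  have G: "lattice_periodic G" "continuous_on UNIV G"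
    unfolding G_def cnj_character using f lattice_periodic_character[OF int_lattice_uminus[OF k]]
    by (auto intro!: lattice_periodic_mult continuous_intros)
  have "character k y * f (x - y) = character k x * G (x - y)" for y
    using character_mult_cnj[of k x] unfolding G_def character_diff_right
    by (simp add: algebra_simps)
  then have "integral (cbox (- H) H) (\<lambda>y. character k y * f (x - y))
      = character k x * integral (cbox (- H) H) (\<lambda>y. G (x - y))" by simp
  also have "integral (cbox (- H) H) (\<lambda>y. G (x - y)) = integral (cbox (- H) H) (G \<circ> (+) x)"
    using integral_reflect[of H "- H" "G \<circ> (+) x"] by simp
  also have "\<dots> = integral (cbox (- H + x) (H + x)) G" by (rule integral_shift_cbox_plus)
  also have "H + x = - H + x + One"
    using half_One[where 'a = 'a] unfolding H_def[symmetric] by (metis add.assoc add.commute)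
  also have "integral (cbox (- H + x) (- H + x + One)) G = integral (cbox 0 (0 + One)) G"
    by (rule integral_unit_cube[OF G])
  finally show ?thesis unfolding H_def by (simp add: fcoeff_def G_def)
qed

text \<open>Convolution is linear in the kernel, and a kernel term of frequency \<open>k\<close>
  returns \<open>fcoeff f k\<close> times that character, hence nothing where the coefficient
  vanishes.\<close>

lemma trig_poly_convolve:
  assumes f: "lattice_periodic f" "continuous_on UNIV f"
    and P: "trig_poly int_lattice (\<lambda>x. of_real (P x))"
  shows "trig_poly {k \<in> int_lattice. fcoeff f k \<noteq> 0} (convolve P f)"
proof -
  define C where "C = cbox (- ((1/2) *\<^sub>R One)) ((1/2) *\<^sub>R One :: 'a)"
  have "trig_poly {k \<in> int_lattice. fcoeff f k \<noteq> 0} (\<lambda>x. integral C (\<lambda>y. g y * f (x - y)))"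
    if "trig_poly int_lattice g" for g
    using that
  proof (induction rule: trig_poly.induct)
    case trig_poly_zero
    then show ?case by (simp add: trig_poly.trig_poly_zero)
  next
    case (trig_poly_insert k g a)
    have int: "(\<lambda>y. h y * f (x - y)) integrable_on C" if "continuous_on UNIV h" for h x
      unfolding C_def using that f(2)
      by (intro integrable_continuous continuous_intros continuous_on_compose2[OF f(2)])
        (auto intro: continuous_on_subset)
    have "continuous_on UNIV g" using trig_poly_insert trig_poly_smooth smooth_fun_continuous_on by blast
    then have add: "integral C (\<lambda>y. (a * character k y + g y) * f (x - y))
        = integral C (\<lambda>y. (a * character k y) * f (x - y)) + integral C (\<lambda>y. g y * f (x - y))" for x
      unfolding distrib_right by (intro integral_add int continuous_intros)
    have "integral C (\<lambda>y. (a * character k y) * f (x - y)) = (a * fcoeff f k) * character k x" for x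
      using integral_character_mult_shift[OF f, of k x] trig_poly_insert(1)
      by (simp add: C_def mult.assoc)
    then have eq: "(\<lambda>x. integral C (\<lambda>y. (a * character k y + g y) * f (x - y)))
      = (\<lambda>x. (a * fcoeff f k) * character k x + integral C (\<lambda>y. g y * f (x - y)))"
      unfolding add by simp
    show ?case
    proof (cases "fcoeff f k = 0")
      case True
      then show ?thesis unfolding eq using trig_poly_insert.IH by simp
    next
      case False
      then show ?thesis unfolding eq using trig_poly_insert by (intro trig_poly.trig_poly_insert) auto
    qed
  qed
  from this[OF P] show ?thesis
    by (simp add: convolve_def average_def[abs_def] C_def scaleR_conv_of_real)
qed

text \<open>\<open>Q\<close> lies between 0 and 1 and within the cube attains 1 only at the origin.
  Far from the origin \<open>Q \<le> q\<close>, whereas \<open>Q \<ge> q' > q\<close> on a small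
  cube \<open>S\<close>, which bounds the normalizing integral \<open>J\<close> from below; so the
  normalized power is at most \<open>(q / q') ^ N\<close> divided by the volume of \<open>S\<close>,
  away from the origin.\<close>

lemma exists_trig_kernel:
  fixes \<delta> \<epsilon> :: real
  assumes "\<delta> > 0" "\<epsilon> > 0"
  obtains P :: "'a::euclidean_space \<Rightarrow> real" where
    "continuous_on UNIV P" "trig_poly int_lattice (\<lambda>x. of_real (P x))" "\<And>y. 0 \<le> P y"
    "integral (cbox (- ((1/2) *\<^sub>R One)) ((1/2) *\<^sub>R One)) P = 1"
    "\<And>y. y \<in> cbox (- ((1/2) *\<^sub>R One)) ((1/2) *\<^sub>R One) \<Longrightarrow> \<delta> \<le> norm y \<Longrightarrow> P y \<le> \<epsilon>"
proof -
  define C where "C = cbox (- ((1/2) *\<^sub>R One)) ((1/2) *\<^sub>R One :: 'a)"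
  define Q where "Q y = (\<Sum>b\<in>Basis. (1 + cos (2 * pi * (b \<bullet> y))) / 2) / DIM('a)" for y :: 'a
  have contQ: "continuous_on S Q" for S unfolding Q_def by (intro continuous_intros) auto
  have "0 \<le> 1 + cos t" for t :: real using cos_ge_minus_one[of t] by linarith
  then have Q0: "0 \<le> Q y" for y unfolding Q_def by (intro divide_nonneg_pos sum_nonneg) auto
  have "(\<Sum>b\<in>(Basis :: 'a set). (1 + cos (2 * pi * (b \<bullet> y))) / 2) \<le> (\<Sum>b\<in>(Basis :: 'a set). 1)" for y
    by (intro sum_mono) auto
  then have Q1: "Q y \<le> 1" for y unfolding Q_def by simp
  have Qlt: "Q y < 1" if y: "y \<in> C" "y \<noteq> 0" for y
  proof -
    obtain b :: 'a where b: "b \<in> Basis" "b \<bullet> y \<noteq> 0"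
      using y(2) by (metis euclidean_all_zero_iff inner_commute)
    \<comment> \<open>In the centred cube the coordinates are at most 1/2 in absolute value, so 0 is
      the only integer that they can equal.\<close>
    have "\<bar>b \<bullet> y\<bar> \<le> 1/2" using y(1) b(1) by (auto simp: C_def mem_box inner_commute inner_sum_right inner_Basis)
    moreover have "cos (2 * pi * (b \<bullet> y)) \<noteq> 1"
    proof
      assume "cos (2 * pi * (b \<bullet> y)) = 1"
      then obtain n :: int where "2 * pi * (b \<bullet> y) = n * 2 * pi" by (auto simp: cos_one_2pi_int)
      then have "b \<bullet> y = n" by simp
      then have "n = 0" using \<open>\<bar>b \<bullet> y\<bar> \<le> 1/2\<close> by linarith
      then show False using \<open>b \<bullet> y = n\<close> b(2) by simp
    qed
    ultimately have "cos (2 * pi * (b \<bullet> y)) < 1" using cos_le_one less_eq_real_def by blast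
    then have "(\<Sum>b\<in>(Basis :: 'a set). (1 + cos (2 * pi * (b \<bullet> y))) / 2) < (\<Sum>b\<in>(Basis :: 'a set). 1)"
      using b(1) by (intro sum_strict_mono_ex1) auto
    then show ?thesis unfolding Q_def by simp
  qed
  have trigQ: "trig_poly int_lattice (\<lambda>y. of_real (Q y))"
  proof -
    have 1: "(1 + cos (2 * pi * (b \<bullet> y))) / 2 / DIM('a)
        = 1 / (2 * DIM('a)) + 1 / (4 * DIM('a)) * (2 * cos (2 * pi * (b \<bullet> y)))" for b y :: 'a
      by (simp add: field_simps)
    have 2: "of_real (2 * cos (2 * pi * (b \<bullet> y))) = character b y + character (- b) y" for b y :: 'a
      by (simp add: character_cis complex_eq_iff)
    have "of_real ((1 + cos (2 * pi * (b \<bullet> y))) / 2 / DIM('a)) = of_real (1 / (2 * DIM('a)))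
          + (of_real (1 / (4 * DIM('a))) * character b y + of_real (1 / (4 * DIM('a))) * character (- b) y)" for b y :: 'a
      unfolding 1 of_real_add of_real_mult[of "1 / real (4 * DIM('a))"] 2 distrib_left ..
    then have "of_real (Q y) = (\<Sum>b\<in>Basis. of_real (1 / (2 * DIM('a)))
          + (of_real (1 / (4 * DIM('a))) * character b y + of_real (1 / (4 * DIM('a))) * character (- b) y))" for y :: 'a
      unfolding Q_def sum_divide_distrib of_real_sum by (intro sum.cong refl)
    then show ?thesis
      by (simp only:) (intro trig_poly_sum trig_poly_add trig_poly_const trig_poly_character
          int_lattice_uminus Basis_subset_int_lattice)
  qed
  obtain q where q: "0 \<le> q" "q < 1" "\<And>y. y \<in> C \<Longrightarrow> \<delta> \<le> norm y \<Longrightarrow> Q y \<le> q"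
  proof (cases "C \<inter> - ball 0 \<delta> = {}")
    case True
    then show ?thesis using that[of 0] by fastforce
  next
    case False
    have "compact (C \<inter> - ball 0 \<delta>)" unfolding C_def by (intro compact_Int_closed) auto
    from continuous_attains_sup[OF this False contQ]
    obtain z where "z \<in> C" "z \<notin> ball 0 \<delta>" "\<forall>y\<in>C \<inter> - ball 0 \<delta>. Q y \<le> Q z" by auto
    then show ?thesis using that[of "Q z"] Q0 Qlt[of z] assms(1) by force
  qed
  \<comment> \<open>Any value strictly between \<open>q\<close> and 1 would do: the gap to
    \<open>q\<close> gives the decay, the gap to 1 makes room for \<open>S\<close>.\<close>
  define q' where "q' = (1 + q) / 2"
  have q': "q < q'" "q' < 1" "0 < q'" using q by (auto simp: q'_def)
  have Qzero: "Q 0 = 1" unfolding Q_def by simp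
  have "isCont Q 0" using contQ[of UNIV] by (simp add: continuous_on_eq_continuous_at)
  then obtain \<rho> where \<rho>: "\<rho> > 0" "\<And>y. norm y < \<rho> \<Longrightarrow> \<bar>Q y - 1\<bar> < 1 - q'"
    using q'(2) Qzero unfolding continuous_at_eps_delta by (metis diff_gt_0_iff_gt diff_zero dist_norm dist_real_def)
  \<comment> \<open>The bound 1/2 keeps \<open>S\<close> inside the cube; the other one makes a
    point with coordinates at most \<open>s\<close> have norm at most \<open>DIM('a) * s\<close>,
    which is less than \<rho>.\<close>
  define s where "s = min (1/2) (\<rho> / (2 * DIM('a)))"
  have s: "0 < s" "s \<le> 1/2" "DIM('a) * s < \<rho>" using \<rho>(1) by (auto simp: s_def min_def field_simps)
  define S where "S = cbox (- (s *\<^sub>R One)) (s *\<^sub>R One :: 'a)"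
  have Ssub: "S \<subseteq> C" unfolding S_def C_def using s(1,2) by (auto simp: subset_box)
  have QS: "q' \<le> Q y" if "y \<in> S" for y
  proof -
    have "norm y \<le> DIM('a) * s"
      using that by (intro norm_le_DIM_times) (auto simp: S_def mem_box)
    then show ?thesis using \<rho>(2)[of y] s(3) by (auto simp: abs_if split: if_splits)
  qed
  have v: "measure lborel S > 0"
    unfolding S_def content_pos_lt_eq using s(1) by auto
  have "(\<lambda>N. (q / q') ^ N) \<longlonglongrightarrow> 0" using q q' by (intro LIMSEQ_realpow_zero) auto
  moreover have "\<epsilon> * measure lborel S > 0" using assms(2) v by simp
  ultimately obtain N where N: "(q / q') ^ N < \<epsilon> * measure lborel S"
    by (metis (no_types, lifting) eventually_sequentially order_refl order_tendsto_iff)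
  define J where "J = integral C (\<lambda>y. Q y ^ N)"
  have int: "(\<lambda>y. Q y ^ N) integrable_on cbox a b" for a b
    by (intro integrable_continuous continuous_intros contQ)
  have "measure lborel S * q' ^ N = integral S (\<lambda>y. q' ^ N)" unfolding S_def by simp
  also have "\<dots> \<le> integral S (\<lambda>y. Q y ^ N)"
    using QS q'(3) int unfolding S_def by (intro integral_le) (auto intro!: power_mono)
  also have "\<dots> \<le> J" unfolding J_def
    using Ssub int Q0 unfolding S_def C_def by (intro integral_subset_le) auto
  finally have J: "measure lborel S * q' ^ N \<le> J" .
  have Jpos: "0 < J" using J v q'(3) by (smt (verit) mult_pos_pos zero_less_power)
  show ?thesis
  proof (rule that[of "\<lambda>y. Q y ^ N / J"])
    show "continuous_on UNIV (\<lambda>y. Q y ^ N / J)" using Jpos by (intro continuous_intros contQ) auto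
    show "trig_poly int_lattice (\<lambda>x. of_real (Q x ^ N / J))"
      using trig_poly_mult[OF trig_poly_const[of "of_real (1 / J)"] trig_poly_power[OF trigQ, of N]]
      by simp
    show "0 \<le> Q y ^ N / J" for y using Q0 Jpos by simp
    show "integral (cbox (- ((1/2) *\<^sub>R One)) ((1/2) *\<^sub>R One)) (\<lambda>y. Q y ^ N / J) = 1"
      using Jpos unfolding C_def[symmetric] by (simp add: J_def)
    fix y :: 'a assume y: "y \<in> cbox (- ((1/2) *\<^sub>R One)) ((1/2) *\<^sub>R One)" "\<delta> \<le> norm y"
    have "Q y ^ N \<le> q ^ N" using q(3) y Q0 by (intro power_mono) (auto simp: C_def)
    also have "\<dots> = (q / q') ^ N * q' ^ N" using q'(3) by (simp add: power_divide)
    also have "\<dots> \<le> \<epsilon> * measure lborel S * q' ^ N" using N q'(3) by (intro mult_right_mono) auto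
    also have "\<dots> \<le> \<epsilon> * J" using J assms(2) by (simp add: mult.assoc)
    finally show "Q y ^ N / J \<le> \<epsilon>" using Jpos by (simp add: divide_le_eq)
  qed
qed

text \<open>Approximate identity with one kernel for the whole family; the family will consist of a
  test function and its derivatives up to the order of a distribution.\<close>

lemma exists_trig_approximation:
  fixes \<F> :: "('a::euclidean_space \<Rightarrow> 'b::banach) set"
  assumes "finite \<F>" and \<F>: "\<And>f. f \<in> \<F> \<Longrightarrow> lattice_periodic f \<and> continuous_on UNIV f"
    and "\<epsilon> > 0"
  shows "\<exists>P. continuous_on UNIV P \<and> trig_poly int_lattice (\<lambda>x. of_real (P x)) \<and>
    (\<forall>f\<in>\<F>. \<forall>x. norm (convolve P f x - f x) \<le> \<epsilon>)"
proof -
  define C where "C = cbox (- ((1/2) *\<^sub>R One)) ((1/2) *\<^sub>R One :: 'a)"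
  have "\<exists>M. \<forall>f\<in>\<F>. \<forall>x. norm (f x) \<le> M"
  proof -
    have "bounded (\<Union>f\<in>\<F>. range f)"
      using assms(1) \<F> lattice_periodic_bounded by (intro bounded_UN) auto
    then show ?thesis unfolding bounded_iff by blast
  qed
  then obtain M0 where "\<And>f x. f \<in> \<F> \<Longrightarrow> norm (f x) \<le> M0" by blast
  \<comment> \<open>The maximum with 1 makes the bound positive, as it becomes a
    denominator.\<close>
  then have M: "max M0 1 > 0" "\<And>f x. f \<in> \<F> \<Longrightarrow> norm (f x) \<le> max M0 1"
    by (auto intro: max.coboundedI1)
  define M where "M = max M0 1"
  note M = M[folded M_def]
  have "\<exists>\<delta>>0. \<forall>f\<in>\<F>. \<forall>x y. norm y < \<delta> \<longrightarrow> norm (f (x + y) - f x) < \<epsilon> / 2"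
    using assms(1) \<F>
  proof (induction \<F>)
    case empty
    show ?case by (intro exI[of _ 1]) auto
  next
    case (insert f \<F>)
    then obtain d where d: "d > 0" "\<And>g x y. g \<in> \<F> \<Longrightarrow> norm y < d \<Longrightarrow> norm (g (x + y) - g x) < \<epsilon> / 2"
      by blast
    have "lattice_periodic f" "continuous_on UNIV f" using insert.prems by auto
    then obtain e where e: "e > 0" "\<And>x y. norm y < e \<Longrightarrow> norm (f (x + y) - f x) < \<epsilon> / 2"
      using lattice_periodic_uniformly_continuous[of f "\<epsilon> / 2"] assms(3) by (metis half_gt_zero)
    then show ?case using d by (intro exI[of _ "min d e"]) auto
  qed
  then obtain \<delta> where \<delta>: "\<delta> > 0"
    "\<And>f x y. f \<in> \<F> \<Longrightarrow> norm y < \<delta> \<Longrightarrow> norm (f (x + y) - f x) < \<epsilon> / 2" by blast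
  \<comment> \<open>Far from the origin the difference of values is at most \<open>2 * M\<close>, so
    this height of the kernel yields half of the error on the cube of volume 1; the near part yields
    the other half.\<close>
  have "\<epsilon> / (4 * M) > 0" using assms(3) M(1) by simp
  from exists_trig_kernel[OF \<delta>(1) this]
  obtain P :: "'a \<Rightarrow> real" where P: "continuous_on UNIV P" "trig_poly int_lattice (\<lambda>x. of_real (P x))"
    "\<And>y. 0 \<le> P y" "integral C P = 1" "\<And>y. y \<in> C \<Longrightarrow> \<delta> \<le> norm y \<Longrightarrow> P y \<le> \<epsilon> / (4 * M)"
    unfolding C_def by metis
  show ?thesis
  proof (intro exI[of _ P] conjI P(1,2) ballI allI)
    fix f and x :: 'a assume f: "f \<in> \<F>"
    have contf: "continuous_on S f" for S using \<F>[OF f] continuous_on_subset by blast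
    have contP: "continuous_on S P" for S using P(1) continuous_on_subset by blast
    have int: "P integrable_on C" "(\<lambda>y. P y *\<^sub>R f (x - y)) integrable_on C" "(\<lambda>y. P y *\<^sub>R f x) integrable_on C"
      unfolding C_def
      by (intro integrable_continuous continuous_intros contP continuous_on_compose2[OF contf[of UNIV]]; simp)+
    have "convolve P f x - f x = integral C (\<lambda>y. P y *\<^sub>R f (x - y)) - integral C (\<lambda>y. P y *\<^sub>R f x)"
      using integral_linear[OF int(1) bounded_linear_scaleR_left[of "f x"]] P(4)
      by (simp add: convolve_def average_def C_def o_def)
    also have "\<dots> = integral C (\<lambda>y. P y *\<^sub>R (f (x - y) - f x))"
      by (subst integral_diff[symmetric, OF int(2,3)]) (simp add: scaleR_diff_right)
    also have "norm \<dots> \<le> integral C (\<lambda>y. (\<epsilon> / 2) * P y + \<epsilon> / 2)"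
    proof (rule integral_norm_bound_integral)
      show "(\<lambda>y. P y *\<^sub>R (f (x - y) - f x)) integrable_on C"
        using integrable_diff[OF int(2,3)] by (simp add: scaleR_diff_right)
      show "(\<lambda>y. (\<epsilon> / 2) * P y + \<epsilon> / 2) integrable_on C"
        unfolding C_def by (intro integrable_continuous continuous_intros contP)
      fix y assume y: "y \<in> C"
      show "norm (P y *\<^sub>R (f (x - y) - f x)) \<le> (\<epsilon> / 2) * P y + \<epsilon> / 2"
      proof (cases "norm y < \<delta>")
        case True
        then have "norm (f (x - y) - f x) \<le> \<epsilon> / 2" using \<delta>(2)[OF f, of "- y" x] by simp
        then have "P y * norm (f (x - y) - f x) \<le> P y * (\<epsilon> / 2)" using P(3) by (intro mult_left_mono)
        then show ?thesis using P(3)[of y] assms(3) by (simp add: mult.commute)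
      next
        case False
        then have "P y \<le> \<epsilon> / (4 * M)" using P(5) y by auto
        moreover have "norm (f (x - y) - f x) \<le> 2 * M"
          using norm_triangle_ineq4[of "f (x - y)" "f x"] M(2)[OF f, of "x - y"] M(2)[OF f, of x] by linarith
        ultimately have "P y * norm (f (x - y) - f x) \<le> \<epsilon> / (4 * M) * (2 * M)"
          using P(3) assms(3) M(1) by (intro mult_mono) auto
        also have "\<dots> = \<epsilon> / 2" using M(1) by simp
        also have "\<dots> \<le> (\<epsilon> / 2) * P y + \<epsilon> / 2" using P(3)[of y] assms(3) by simp
        finally show ?thesis using P(3) by simp
      qed
    qed
    also have "\<dots> = integral C (\<lambda>y. (\<epsilon> / 2) * P y) + integral C (\<lambda>y. \<epsilon> / 2)"
      unfolding C_def by (intro integral_add integrable_continuous continuous_intros contP)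
    also have "\<dots> = \<epsilon>" using P(4) content_centred_cube[where 'a = 'a] by (simp add: C_def)
    finally show "norm (convolve P f x - f x) \<le> \<epsilon>" .
  qed
qed


section \<open>Averages along closed lines\<close>

lemma lattice_periodic_diff:
  "lattice_periodic f \<Longrightarrow> lattice_periodic g \<Longrightarrow> lattice_periodic (\<lambda>x. f x - g x)"
  by (simp add: lattice_periodic_def)

lemma lattice_periodic_average: "lattice_periodic f \<Longrightarrow> lattice_periodic (average p q k L f)"
  unfolding lattice_periodic_def average_def
  by (auto intro!: arg_cong[where f = "integral (cbox p q)"] simp: fun_eq_iff) (metis add.assoc add.commute)

lemma lattice_periodic_partial:
  assumes "lattice_periodic f" "\<And>x. f differentiable (at x)"
  shows "lattice_periodic (partial b f)"
  unfolding lattice_periodic_def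
proof safe
  fix x z :: 'a assume z: "z \<in> int_lattice"
  have "((\<lambda>y. f (y + z)) has_derivative frechet_derivative f (at (x + z))) (at x)"
    by (rule has_derivative_compose[where f = "\<lambda>y. y + z" and f' = "\<lambda>h. h", unfolded o_def])
       (use assms(2) in \<open>auto intro!: derivative_eq_intros simp: frechet_derivative_works\<close>)
  then show "partial b f (x + z) = partial b f x"
    using partial_eqI[of "\<lambda>y. f (y + z)"] lattice_periodicD[OF assms(1) z] by simp
qed

lemma lattice_periodic_iter_partial:
  "smooth_fun f \<Longrightarrow> lattice_periodic f \<Longrightarrow> bs \<in> lists Basis \<Longrightarrow> lattice_periodic (iter_partial bs f)"
  by (induction bs)
     (auto intro!: lattice_periodic_partial smooth_fun_differentiable smooth_fun_iter_partial)

abbreviation line_average :: "'a::euclidean_space \<Rightarrow> ('a \<Rightarrow> 'b::banach) \<Rightarrow> 'a \<Rightarrow> 'b" where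
  "line_average w \<equiv> average (0::real) 1 (\<lambda>_. 1) (\<lambda>\<tau>. \<tau> *\<^sub>R w)"

lemma line_average_eq: "line_average w f x = integral {0..1} (\<lambda>\<tau>. f (x + \<tau> *\<^sub>R w))"
  by (simp add: average_def)

lemma line_integrable:
  fixes f :: "'a::euclidean_space \<Rightarrow> 'b::banach"
  assumes "continuous_on UNIV f"
  shows "(\<lambda>\<tau>. f (x + \<tau> *\<^sub>R w)) integrable_on {0..1::real}"
  by (intro integrable_continuous_interval continuous_on_compose2[OF assms] continuous_intros) auto

lemma line_average_add:
  assumes "continuous_on UNIV f" "continuous_on UNIV g"
  shows "line_average w (\<lambda>x. f x + g x) = (\<lambda>x. line_average w f x + line_average w g x)"
  unfolding line_average_eq[abs_def] using assms by (simp add: integral_add line_integrable)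

lemma line_average_diff:
  assumes "continuous_on UNIV f" "continuous_on UNIV g"
  shows "line_average w (\<lambda>x. f x - g x) = (\<lambda>x. line_average w f x - line_average w g x)"
  unfolding line_average_eq[abs_def] using assms by (simp add: integral_diff line_integrable)

lemma norm_line_average_le:
  assumes "continuous_on UNIV f" "\<And>x. norm (f x) \<le> B"
  shows "norm (line_average w f x) \<le> B"
proof -
  have "norm (integral {0..1} (\<lambda>\<tau>. f (x + \<tau> *\<^sub>R w))) \<le> integral {0..1} (\<lambda>\<tau>::real. B)"
    using assms by (intro integral_norm_bound_integral line_integrable) auto
  then show ?thesis by (simp add: line_average_eq)
qed

lemma line_average_character:
  assumes "k \<in> int_lattice" "w \<in> int_lattice"
  shows "line_average w (\<lambda>x. a * character k x) = (\<lambda>x. (if k \<bullet> w = 0 then a else 0) * character k x)"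
proof
  fix x
  obtain n :: int where n: "k \<bullet> w = n" using inner_int_lattice[OF assms] by (auto elim: Ints_cases)
  \<comment> \<open>Restricted to the line, the character is a multiple of
    \<open>exp (\<tau> c)\<close>. As \<open>n\<close> is an integer, a nonzero \<open>c\<close>
    gives an antiderivative with equal values at both ends.\<close>
  define c where "c = 2 * of_real pi * \<i> * of_int n"
  have eq: "a * character k (x + \<tau> *\<^sub>R w) = a * character k x * exp (\<tau> *\<^sub>R c)" for \<tau> :: real
    unfolding character_add_right c_def
    by (simp add: character_def n algebra_simps scaleR_conv_of_real)
  show "line_average w (\<lambda>x. a * character k x) x = (if k \<bullet> w = 0 then a else 0) * character k x"
  proof (cases "n = 0")
    case True
    then show ?thesis unfolding line_average_eq eq by (simp add: c_def n)
  next
    case False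
    then have c: "c \<noteq> 0" by (simp add: c_def)
    have "exp c = 1" unfolding c_def by (simp add: exp_eq_1)
    have "((\<lambda>\<tau>. exp (\<tau> *\<^sub>R c) / c) has_vector_derivative exp (\<tau> *\<^sub>R c)) (at \<tau> within {0..1})" for \<tau> :: real
      using c exp_scaleR_has_vector_derivative_right[of c \<tau> "{0..1}"]
      by (auto intro!: derivative_eq_intros)
    then have "((\<lambda>\<tau>. exp (\<tau> *\<^sub>R c)) has_integral (exp (1 *\<^sub>R c) / c - exp (0 *\<^sub>R c) / c)) {0..1}"
      by (intro fundamental_theorem_of_calculus) auto
    then have "((\<lambda>\<tau>. exp (\<tau> *\<^sub>R c)) has_integral 0) {0..1}" using \<open>exp c = 1\<close> by simp
    then show ?thesis unfolding line_average_eq eq using False n by (simp add: integral_unique)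
  qed
qed

lemma trig_poly_line_average:
  assumes "trig_poly \<Lambda> g" "\<Lambda> \<subseteq> int_lattice" "w \<in> int_lattice"
  shows "trig_poly {k \<in> \<Lambda>. k \<bullet> w = 0} (line_average w g)"
  using assms(1)
proof (induction rule: trig_poly.induct)
  case trig_poly_zero
  then show ?case by (simp add: average_def[abs_def] trig_poly.trig_poly_zero)
next
  case (trig_poly_insert k g a)
  have g: "continuous_on UNIV g" using trig_poly_insert trig_poly_smooth smooth_fun_continuous_on by blast
  have "continuous_on UNIV (\<lambda>x. a * character k x)" by (intro continuous_intros)
  from line_average_add[OF this g, of w]
  have eq: "line_average w (\<lambda>x. a * character k x + g x)
      = (\<lambda>x. (if k \<bullet> w = 0 then a else 0) * character k x + line_average w g x)"
    using assms(2,3) trig_poly_insert(1) by (simp add: line_average_character subset_iff)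
  show ?case unfolding eq
  proof (cases "k \<bullet> w = 0")
    case True
    then show "trig_poly {k \<in> \<Lambda>. k \<bullet> w = 0}
        (\<lambda>x. (if k \<bullet> w = 0 then a else 0) * character k x + line_average w g x)"
      using trig_poly_insert by (intro trig_poly.trig_poly_insert) auto
  qed (use trig_poly_insert in simp)
qed

lemma trig_poly_empty: "trig_poly {} g \<Longrightarrow> g = (\<lambda>x. 0)"
  by (induction rule: trig_poly.induct) auto

section \<open>Vanishing averages and Fourier coefficients\<close>

text \<open>If \<open>k\<close> is orthogonal to \<open>w\<close>, the character is constant along
  the lines, so by Fubini \<open>f\<close> and its average have the same coefficient at
  \<open>k\<close>. Conversely, the approximating polynomials use only frequencies at which
  \<open>f\<close> has a nonzero coefficient; none is orthogonal to \<open>w\<close>, and their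
  averages vanish identically.\<close>

lemma line_average_eq_0_iff:
  fixes f :: "'a::euclidean_space \<Rightarrow> complex"
  assumes f: "lattice_periodic f" "continuous_on UNIV f" and w: "w \<in> int_lattice"
  shows "(\<forall>x. line_average w f x = 0) \<longleftrightarrow> (\<forall>k\<in>int_lattice. k \<bullet> w = 0 \<longrightarrow> fcoeff f k = 0)"
proof (intro iffI ballI impI allI)
  fix k :: 'a assume 0: "\<forall>x. line_average w f x = 0" and k: "k \<in> int_lattice" "k \<bullet> w = 0"
  define h where "h = (\<lambda>x. f x * cnj (character k x))"
  have h: "lattice_periodic h" "continuous_on UNIV h"
    unfolding h_def cnj_character using f lattice_periodic_character[OF int_lattice_uminus[OF k(1)]]
    by (auto intro!: lattice_periodic_mult continuous_intros)
  have shift: "h (x + \<tau> *\<^sub>R w) = cnj (character k x) * f (x + \<tau> *\<^sub>R w)" for x \<tau>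
    using k(2) by (simp add: h_def character_add_right character_eq_1[of k "\<tau> *\<^sub>R w"])
  have const: "integral (cbox 0 One) (\<lambda>x. h (x + \<tau> *\<^sub>R w)) = fcoeff f k" for \<tau> :: real
  proof -
    have "integral (cbox 0 One) (\<lambda>x. h (x + \<tau> *\<^sub>R w)) = integral (cbox (0 + \<tau> *\<^sub>R w) (One + \<tau> *\<^sub>R w)) h"
      unfolding integral_shift_cbox_plus[symmetric] by (simp add: o_def add.commute)
    also have "\<dots> = integral (cbox 0 One) h"
      using integral_unit_cube[OF h, of "\<tau> *\<^sub>R w" 0] by (simp add: add.commute)
    finally show ?thesis by (simp add: fcoeff_def h_def)
  qed
  have "fcoeff f k = integral (cbox 0 1) (\<lambda>\<tau>::real. integral (cbox 0 One) (\<lambda>x. h (x + \<tau> *\<^sub>R w)))"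
    unfolding const by simp
  also have "\<dots> = integral (cbox 0 One) (\<lambda>x. integral (cbox 0 (1::real)) (\<lambda>\<tau>. h (x + \<tau> *\<^sub>R w)))"
    unfolding split_def
    by (intro integral_swap_continuous) (auto intro!: continuous_intros continuous_on_compose2[OF h(2)] simp: split_def)
  also have "\<dots> = integral (cbox 0 One) (\<lambda>x::'a. 0)"
    unfolding shift using 0 by (simp add: line_average_eq)
  finally show "fcoeff f k = 0" by simp
next
  fix x :: 'a assume 0: "\<forall>k\<in>int_lattice. k \<bullet> w = 0 \<longrightarrow> fcoeff f k = 0"
  have "norm (line_average w f x) \<le> 0 + \<epsilon>" if pos: "\<epsilon> > 0" for \<epsilon>
  proof -
    have fin: "finite {f}" and per: "\<And>g. g \<in> {f} \<Longrightarrow> lattice_periodic g \<and> continuous_on UNIV g"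
      using f by auto
    obtain P where P: "continuous_on UNIV P" "trig_poly int_lattice (\<lambda>x. of_real (P x))"
      and app: "\<And>x. norm (convolve P f x - f x) \<le> \<epsilon>"
      using exists_trig_approximation[OF fin per pos] by auto
    have T: "trig_poly {k \<in> int_lattice. fcoeff f k \<noteq> 0} (convolve P f)"
      by (rule trig_poly_convolve[OF f P(2)])
    have "trig_poly {k \<in> {k \<in> int_lattice. fcoeff f k \<noteq> 0}. k \<bullet> w = 0} (line_average w (convolve P f))"
      by (rule trig_poly_line_average[OF T _ w]) auto
    moreover have "{k \<in> {k \<in> int_lattice. fcoeff f k \<noteq> 0}. k \<bullet> w = 0} = {}" using 0 by auto
    ultimately have "line_average w (convolve P f) = (\<lambda>x. 0)" using trig_poly_empty by metis
    moreover have "continuous_on UNIV (convolve P f)"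
      using T trig_poly_smooth smooth_fun_continuous_on by blast
    ultimately have "line_average w (\<lambda>x. convolve P f x - f x) x = - line_average w f x"
      "continuous_on UNIV (\<lambda>x. convolve P f x - f x)"
      using f(2) by (auto simp: line_average_diff intro!: continuous_intros)
    then show ?thesis using norm_line_average_le[of "\<lambda>x. convolve P f x - f x" \<epsilon> w x] app by simp
  qed
  then have "norm (line_average w f x) \<le> 0" by (rule field_le_epsilon)
  then show "line_average w f x = 0" by simp
qed

text \<open>Orthogonal characters are their own averages, which gives one direction. For the other,
  the average of an approximating polynomial has only orthogonal frequencies, where \<open>U\<close>
  vanishes, and the error is controlled in the norm for which \<open>U\<close> is continuous. The
  abstract \<open>U\<close> covers a distribution multiplied by \<open>sqrt c\<close>.\<close>

lemma functional_line_average_eq_0_iff: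
  fixes U :: "('a::euclidean_space \<Rightarrow> complex) \<Rightarrow> complex"
  assumes add: "\<And>\<phi> \<psi>. smooth_fun \<phi> \<Longrightarrow> lattice_periodic \<phi> \<Longrightarrow> smooth_fun \<psi> \<Longrightarrow> lattice_periodic \<psi> \<Longrightarrow>
      U (\<lambda>x. \<phi> x + \<psi> x) = U \<phi> + U \<psi>"
    and scale: "\<And>a \<phi>. smooth_fun \<phi> \<Longrightarrow> lattice_periodic \<phi> \<Longrightarrow> U (\<lambda>x. a * \<phi> x) = a * U \<phi>"
    and cont: "\<And>\<phi> B. smooth_fun \<phi> \<Longrightarrow> lattice_periodic \<phi> \<Longrightarrow> bound_upto m B \<phi> \<Longrightarrow> norm (U \<phi>) \<le> C * B"
    and w: "w \<in> int_lattice"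
  shows "(\<forall>\<phi>. smooth_fun \<phi> \<longrightarrow> lattice_periodic \<phi> \<longrightarrow> U (line_average w \<phi>) = 0) \<longleftrightarrow>
      (\<forall>k\<in>int_lattice. k \<bullet> w = 0 \<longrightarrow> U (character k) = 0)"
proof (intro iffI ballI impI allI)
  fix k :: 'a
  assume 0: "\<forall>\<phi>. smooth_fun \<phi> \<longrightarrow> lattice_periodic \<phi> \<longrightarrow> U (line_average w \<phi>) = 0"
    and k: "k \<in> int_lattice" "k \<bullet> w = 0"
  have "line_average w (character k) = character k"
    using line_average_character[OF k(1) w, of 1] k(2) by simp
  then show "U (character k) = 0"
    using 0[rule_format, of "character k"] smooth_fun_character[of 1 k] lattice_periodic_character[OF k(1)]
    by simp
next
  fix \<phi> :: "'a \<Rightarrow> complex"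
  assume 0: "\<forall>k\<in>int_lattice. k \<bullet> w = 0 \<longrightarrow> U (character k) = 0"
    and \<phi>: "smooth_fun \<phi>" "lattice_periodic \<phi>"
  have U0: "U g = 0" if "trig_poly {k \<in> int_lattice. k \<bullet> w = 0} g" for g
    using that
  proof (induction rule: trig_poly.induct)
    case trig_poly_zero
    then show ?case using scale[OF \<phi>, of 0] by simp
  next
    case (trig_poly_insert k g a)
    have "U (\<lambda>x. a * character k x + g x) = U (\<lambda>x. a * character k x) + U g"
      using trig_poly_insert smooth_fun_character[of a k] trig_poly_smooth
        trig_poly_periodic[OF trig_poly_insert(2)] trig_poly_periodic[OF trig_poly_character[of k int_lattice a]]
      by (intro add) auto
    also have "U (\<lambda>x. a * character k x) = a * U (character k)"
      using scale[of "character k" a] smooth_fun_character[of 1 k] lattice_periodic_character[of k]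
        trig_poly_insert(1) by simp
    finally show ?case using trig_poly_insert 0 by simp
  qed
  have bound: "norm (U (line_average w \<phi>)) \<le> C * \<epsilon>" if pos: "\<epsilon> > 0" for \<epsilon>
  proof -
    \<comment> \<open>Convolution commutes with derivatives, so uniform approximation of all of
      these by one kernel is approximation of \<phi> in the \<open>m\<close>-th norm.\<close>
    define \<F> where "\<F> = (\<lambda>bs. iter_partial bs \<phi>) ` {bs. set bs \<subseteq> Basis \<and> length bs \<le> m}"
    have fin: "finite \<F>" unfolding \<F>_def by (intro finite_imageI finite_lists_length_le) auto
    have per: "lattice_periodic f \<and> continuous_on UNIV f" if "f \<in> \<F>" for f
      using that \<phi> unfolding \<F>_def
      by (auto intro!: lattice_periodic_iter_partial smooth_fun_continuous_on smooth_fun_iter_partial)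
    obtain P where P: "continuous_on UNIV P" "trig_poly int_lattice (\<lambda>x. of_real (P x))"
      and app: "\<And>f x. f \<in> \<F> \<Longrightarrow> norm (convolve P f x - f x) \<le> \<epsilon>"
      using exists_trig_approximation[OF fin per pos] by blast
    define \<psi> where "\<psi> = convolve P \<phi>"
    have T: "trig_poly {k \<in> int_lattice. fcoeff \<phi> k \<noteq> 0} \<psi>"
      unfolding \<psi>_def using \<phi> P(2) smooth_fun_continuous_on by (intro trig_poly_convolve)
    then have T: "trig_poly int_lattice \<psi>"
      by (induction rule: trig_poly.induct) (auto intro: trig_poly.intros)
    have \<psi>: "smooth_fun \<psi>" "lattice_periodic \<psi>"
      using trig_poly_smooth[OF T] trig_poly_periodic[OF T] by auto
    define \<eta> where "\<eta> = (\<lambda>x. \<psi> x - \<phi> x)"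
    have \<eta>: "smooth_fun \<eta>" "lattice_periodic \<eta>"
      unfolding \<eta>_def using \<phi> \<psi> by (auto intro: smooth_fun_diff lattice_periodic_diff)
    have line: "smooth_fun (line_average w f)" "lattice_periodic (line_average w f)"
      if "smooth_fun f" "lattice_periodic f" for f :: "'a \<Rightarrow> complex"
      using that by (auto intro!: smooth_fun_average lattice_periodic_average continuous_intros)
    have "bound_upto m \<epsilon> (line_average w \<eta>)"
      unfolding bound_upto_def
    proof (intro ballI impI allI)
      fix bs :: "'a list" and x assume bs: "bs \<in> lists Basis" "length bs \<le> m"
      have "iter_partial bs \<psi> = convolve P (iter_partial bs \<phi>)"
        unfolding \<psi>_def convolve_def using P(1) \<phi>(1) bs(1)
        by (intro iter_partial_average) (auto intro!: continuous_intros intro: continuous_on_subset)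
      then have "iter_partial bs \<eta> = (\<lambda>x. convolve P (iter_partial bs \<phi>) x - iter_partial bs \<phi> x)"
        unfolding \<eta>_def using iter_partial_diff[OF \<psi>(1) \<phi>(1) bs(1)] by simp
      moreover have "iter_partial bs \<phi> \<in> \<F>" using bs unfolding \<F>_def by auto
      ultimately have "norm (iter_partial bs \<eta> x) \<le> \<epsilon>" for x using app by simp
      moreover have "iter_partial bs (line_average w \<eta>) = line_average w (iter_partial bs \<eta>)"
        using \<eta>(1) bs(1) by (intro iter_partial_average continuous_intros)
      ultimately show "norm (iter_partial bs (line_average w \<eta>) x) \<le> \<epsilon>"
        using smooth_fun_continuous_on[OF smooth_fun_iter_partial[OF \<eta>(1) bs(1)]]
        by (simp add: norm_line_average_le)
    qed
    then have *: "norm (U (line_average w \<eta>)) \<le> C * \<epsilon>" using cont line[OF \<eta>] by blast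
    have "\<psi> = (\<lambda>x. \<phi> x + \<eta> x)" by (simp add: \<eta>_def)
    then have "line_average w \<psi> = (\<lambda>x. line_average w \<phi> x + line_average w \<eta> x)"
      using line_average_add[of \<phi> \<eta> w] \<phi>(1) \<eta>(1) by (simp add: smooth_fun_continuous_on)
    then have "U (line_average w \<psi>) = U (line_average w \<phi>) + U (line_average w \<eta>)"
      using add line[OF \<phi>] line[OF \<eta>] by simp
    moreover have "U (line_average w \<psi>) = 0"
      using U0 trig_poly_line_average[OF T order_refl w] by blast
    ultimately have "U (line_average w \<phi>) = - U (line_average w \<eta>)" by (simp add: eq_neg_iff_add_eq_0)
    then show ?thesis using * by simp
  qed
  \<comment> \<open>The sign of \<open>C\<close> is unknown, so the error is removed by a limit
    instead of dividing by \<open>C\<close>.\<close>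
  have "((\<lambda>\<epsilon>. C * \<epsilon>) \<longlongrightarrow> C * 0) (at_right 0)" by (intro tendsto_intros)
  moreover have "\<forall>\<^sub>F \<epsilon> in at_right 0. norm (U (line_average w \<phi>)) \<le> C * \<epsilon>"
    using bound by (auto simp: eventually_at_right_field intro!: exI[of _ 1])
  ultimately have "norm (U (line_average w \<phi>)) \<le> C * 0"
    by (intro tendsto_lowerbound) auto
  then show "U (line_average w \<phi>) = 0" by simp
qed


section \<open>Closed null geodesics\<close>

lemma Basis_spacetime:
  "(Basis :: ((real^'n) \<times> real) set) = (\<lambda>i. (axis i 1, 0)) ` UNIV \<union> {(0, 1)}"
  by (auto simp: Basis_prod_def Basis_vec_def)

lemma int_lattice_spacetime_iff:
  "(z :: (real^'n) \<times> real) \<in> int_lattice \<longleftrightarrow> (\<forall>i. fst z $ i \<in> \<int>) \<and> snd z \<in> \<int>"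
  by (cases z) (auto simp: int_lattice_def Basis_spacetime inner_axis)

lemma lattice_vec_in_int_lattice: "lattice_vec w \<in> int_lattice"
  by (simp add: int_lattice_spacetime_iff lattice_vec_def rvec_def)

lemma int_lattice_eq_range: "int_lattice = range lattice_vec"
proof (intro equalityI subsetI)
  fix z :: "(real^'n) \<times> real" assume "z \<in> int_lattice"
  then have "z = lattice_vec ((\<chi> i. \<lfloor>fst z $ i\<rfloor>), \<lfloor>snd z\<rfloor>)"
    by (cases z) (auto simp: int_lattice_spacetime_iff lattice_vec_def rvec_def vec_eq_iff)
  then show "z \<in> range lattice_vec" by blast
qed (auto simp: lattice_vec_in_int_lattice)

lemma periodic_fun_iff: "periodic_fun f \<longleftrightarrow> lattice_periodic f"
  by (auto simp: periodic_fun_def lattice_periodic_def int_lattice_eq_range)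

lemma inner_lattice_vec:
  "lattice_vec (v, s) \<bullet> lattice_vec (k, t) = rvec v \<bullet> rvec k + real_of_int s * real_of_int t"
  by (simp add: lattice_vec_def)

text \<open>The pairing is Euclidean, not Lorentzian; in this form \<open>K\<close> is the union of
  the hyperplanes detected by the averages along null directions.\<close>

lemma null_frequencies_eq:
  "null_frequencies = {\<kappa>. \<exists>w\<in>null_lattice. lattice_vec w \<bullet> lattice_vec \<kappa> = 0}"
  unfolding null_frequencies_def null_lattice_def by (auto simp: inner_lattice_vec; blast)

text \<open>For a null vector the space part is as long as the time part, so excluding
  \<open>s = 0\<close> excludes exactly the zero vector.\<close>

lemma null_lattice_iff:
  "w \<in> null_lattice \<longleftrightarrow> lattice_vec w \<noteq> 0 \<and> minkowski x (lattice_vec w) (lattice_vec w) = 0"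
proof (cases w)
  case (Pair v s)
  have "minkowski x (lattice_vec (v, s)) (lattice_vec (v, s)) = (norm (rvec v))\<^sup>2 - (real_of_int s)\<^sup>2"
    unfolding power2_norm_eq_inner by (simp add: minkowski_def lattice_vec_def power2_eq_square)
  moreover have "lattice_vec (v, s) \<noteq> 0 \<longleftrightarrow> s \<noteq> 0" if "(norm (rvec v))\<^sup>2 = (real_of_int s)\<^sup>2"
    using that by (auto simp: lattice_vec_def zero_prod_def)
  ultimately show ?thesis unfolding Pair null_lattice_def by auto
qed

section \<open>Geodesics of the flat metric\<close>

lemma minkowski_scaleR_left: "minkowski x (r *\<^sub>R u) v = r * minkowski x u v"
  by (simp add: minkowski_def algebra_simps)

lemma minkowski_scaleR_right: "minkowski x u (r *\<^sub>R v) = r * minkowski x u v"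
  by (simp add: minkowski_def algebra_simps)

lemma minkowski_nondegenerate:
  assumes "\<And>u. minkowski x v u = 0"
  shows "v = 0"
  using assms[of "(fst v, 0)"] assms[of "(0, snd v)"] by (auto simp: minkowski_def prod_eq_iff)

lemma christoffel_first_minkowski: "christoffel_first minkowski x a b u = 0"
  by (simp add: christoffel_first_def minkowski_def frechet_derivative_const)

text \<open>The Christoffel symbols vanish, so nondegeneracy turns the lowered equation into
  \<open>\<gamma>'' = 0\<close>; two constancy arguments integrate it.\<close>

lemma geodesic_minkowski_affine:
  assumes "geodesic minkowski \<gamma>"
  shows "\<exists>v. (\<forall>\<tau>. \<gamma> \<tau> = \<gamma> 0 + \<tau> *\<^sub>R v) \<and> (\<forall>\<tau>. vector_derivative \<gamma> (at \<tau>) = v)"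
proof -
  obtain \<gamma>' \<gamma>'' where d: "\<And>\<tau>. (\<gamma> has_vector_derivative \<gamma>' \<tau>) (at \<tau>)"
      "\<And>\<tau>. (\<gamma>' has_vector_derivative \<gamma>'' \<tau>) (at \<tau>)"
    and "\<And>\<tau> u. minkowski (\<gamma> \<tau>) (\<gamma>'' \<tau>) u + christoffel_first minkowski (\<gamma> \<tau>) (\<gamma>' \<tau>) (\<gamma>' \<tau>) u = 0"
    using assms unfolding geodesic_def by blast
  then have "\<gamma>'' \<tau> = 0" for \<tau>
    by (intro minkowski_nondegenerate) (simp add: christoffel_first_minkowski)
  then have "(\<gamma>' has_derivative (\<lambda>h. 0)) (at \<tau> within UNIV)" for \<tau>
    using d(2)[of \<tau>] by (simp add: has_vector_derivative_def)
  then have c: "\<gamma>' \<tau> = \<gamma>' 0" for \<tau>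
    using has_derivative_zero_constant[of UNIV \<gamma>'] by (metis UNIV_I convex_UNIV)
  have d0: "(\<gamma> has_vector_derivative \<gamma>' 0) (at \<tau>)" for \<tau>
    using d(1)[of \<tau>] c[of \<tau>] by simp
  have "((\<lambda>\<tau>. \<gamma> \<tau> - \<tau> *\<^sub>R \<gamma>' 0) has_vector_derivative 0) (at \<tau>)" for \<tau>
    by (auto intro!: derivative_eq_intros d0)
  then have "((\<lambda>\<tau>. \<gamma> \<tau> - \<tau> *\<^sub>R \<gamma>' 0) has_derivative (\<lambda>h. 0)) (at \<tau> within UNIV)" for \<tau>
    by (simp add: has_vector_derivative_def)
  then obtain a where "\<And>\<tau>. \<gamma> \<tau> - \<tau> *\<^sub>R \<gamma>' 0 = a"
    using has_derivative_zero_constant[of UNIV "\<lambda>\<tau>. \<gamma> \<tau> - \<tau> *\<^sub>R \<gamma>' 0"] by auto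
  then have aff: "\<gamma> \<tau> = \<gamma> 0 + \<tau> *\<^sub>R \<gamma>' 0" for \<tau>
    by (metis add_diff_cancel_left' add.commute diff_add_cancel diff_zero scaleR_zero_left)
  from aff vector_derivative_at[OF d0] show ?thesis by blast
qed

text \<open>The displacement of an affine curve over the period 1 is its velocity, so closing up on
  the torus makes the velocity a lattice vector.\<close>

lemma closed_null_geodesic_minkowski:
  assumes "closed_null_geodesic minkowski \<gamma> 1"
  shows "\<exists>w\<in>null_lattice. \<forall>\<tau>. \<gamma> \<tau> = \<gamma> 0 + \<tau> *\<^sub>R lattice_vec w"
proof -
  have g: "geodesic minkowski \<gamma>" using assms by (simp add: closed_null_geodesic_def null_geodesic_def)
  obtain v where v: "\<And>\<tau>. \<gamma> \<tau> = \<gamma> 0 + \<tau> *\<^sub>R v" "\<And>\<tau>. vector_derivative \<gamma> (at \<tau>) = v"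
    using geodesic_minkowski_affine[OF g] by blast
  obtain w where "\<gamma> (0 + 1) = \<gamma> 0 + lattice_vec w"
    using assms unfolding closed_null_geodesic_def by blast
  then have vw: "v = lattice_vec w" using v(1)[of 1] by (metis add_0 add_left_cancel scaleR_one)
  have "v \<noteq> 0 \<and> minkowski (\<gamma> 0) v v = 0"
    using assms unfolding closed_null_geodesic_def null_geodesic_def v(2) by blast
  then have "w \<in> null_lattice" using null_lattice_iff unfolding vw by blast
  then show ?thesis using v(1) unfolding vw by blast
qed

lemma line_closed_null_geodesic:
  assumes "w \<in> null_lattice"
  shows "closed_null_geodesic minkowski (\<lambda>\<tau>. x + \<tau> *\<^sub>R lattice_vec w) 1"
proof -
  have d: "((\<lambda>\<tau>. x + \<tau> *\<^sub>R lattice_vec w) has_vector_derivative lattice_vec w) (at \<tau>)" for \<tau>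
    by (auto intro!: derivative_eq_intros)
  have "geodesic minkowski (\<lambda>\<tau>. x + \<tau> *\<^sub>R lattice_vec w)"
    unfolding geodesic_def using d
    by (intro exI[of _ "\<lambda>_. lattice_vec w"] exI[of _ "\<lambda>_. 0"])
       (auto simp: christoffel_first_minkowski, simp add: minkowski_def)
  moreover have "lattice_vec w \<noteq> 0 \<and> minkowski y (lattice_vec w) (lattice_vec w) = 0" for y
    using assms null_lattice_iff by blast
  moreover have "x + (\<tau> + 1) *\<^sub>R lattice_vec w = x + \<tau> *\<^sub>R lattice_vec w + lattice_vec w" for \<tau>
    by (simp add: scaleR_add_left)
  ultimately show ?thesis
    unfolding closed_null_geodesic_def null_geodesic_def vector_derivative_at[OF d]
    using zero_less_one by blast
qed

section \<open>Reparametrization by the conformal factor\<close>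

text \<open>\<open>h\<close> is a primitive of \<open>g\<close>, \<open>p\<close> its inverse and
  \<open>S\<close> the integral of \<open>g\<close> over a period. With \<open>g\<close> the
  conformal factor along a null line, \<open>h\<close> turns the flat parameter into an affine one
  for \<open>c g\<close>. It is onto because it grows by the positive amount \<open>S\<close> in
  each period.\<close>

lemma periodic_positive_reparametrization:
  fixes g :: "real \<Rightarrow> real"
  assumes cont: "continuous_on UNIV g" and pos: "\<And>\<tau>. g \<tau> > 0" and per: "\<And>\<tau>. g (\<tau> + 1) = g \<tau>"
  shows "\<exists>h p S. strict_mono h \<and> surj h \<and> (\<forall>\<tau>. h (\<tau> + 1) = h \<tau> + S) \<and> S > 0 \<and>
    (\<forall>\<tau>. p (h \<tau>) = \<tau>) \<and> (\<forall>s. p (s + S) = p s + 1) \<and>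
    (\<forall>s. (p has_real_derivative inverse (g (p s))) (at s))"
proof -
  obtain h where "\<And>\<tau>. (h has_vector_derivative g \<tau>) (at \<tau>)"
    using einterval_antiderivative[of "-\<infinity>" "\<infinity>" g] cont by (auto simp: continuous_on_eq_continuous_at)
  then have h: "(h has_real_derivative g \<tau>) (at \<tau>)" for \<tau>
    by (simp add: has_real_derivative_iff_has_vector_derivative)
  have mono: "h a < h b" if "a < b" for a b
    by (rule DERIV_pos_imp_increasing[OF that], rule exI, rule conjI, rule h, rule pos)
  have hcont: "isCont h \<tau>" for \<tau> using h DERIV_isCont by blast
  define S where "S = h 1 - h 0"
  have S: "S > 0" using mono[of 0 1] by (simp add: S_def)
  have hS: "h (\<tau> + 1) = h \<tau> + S" for \<tau>
  proof -
    have "((\<lambda>\<tau>. h (\<tau> + 1) - h \<tau>) has_real_derivative g (t + 1) - g t) (at t)" for t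
      using h[of "t + 1"] by (intro DERIV_diff h) (simp add: DERIV_shift)
    then have "\<forall>t. ((\<lambda>\<tau>. h (\<tau> + 1) - h \<tau>) has_real_derivative 0) (at t)" by (simp add: per)
    from DERIV_isconst_all[OF this, of \<tau> 0] show ?thesis by (simp add: S_def)
  qed
  have hn: "h (real n) = h 0 + real n * S" for n
  proof (induction n)
    case (Suc n)
    then show ?case using hS[of "real n"] by (simp add: algebra_simps)
  qed simp
  have hm: "h (- real n) = h 0 - real n * S" for n
  proof (induction n)
    case (Suc n)
    then show ?case using hS[of "- real (Suc n)"] by (simp add: algebra_simps)
  qed simp
  have surj: "surj h"
    unfolding surj_def
  proof
    fix y
    obtain n where n: "\<bar>y - h 0\<bar> / S < real n" using reals_Archimedean2 by blast
    then have "\<bar>y - h 0\<bar> < real n * S" using S by (simp add: divide_less_eq)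
    then have "h (- real n) \<le> y" "y \<le> h (real n)" unfolding hn hm by linarith+
    then show "\<exists>x. y = h x" using IVT[of h "- real n" y "real n"] hcont by auto
  qed
  have smono: "strict_mono h" using mono by (simp add: strict_mono_def)
  define p where "p = inv h"
  have ph: "p (h \<tau>) = \<tau>" for \<tau> unfolding p_def using smono by (simp add: strict_mono_imp_inj_on)
  have hp: "h (p s) = s" for s unfolding p_def using surj by (simp add: surj_f_inv_f)
  have pS: "p (s + S) = p s + 1" for s using hS[of "p s"] ph[of "p s + 1"] by (simp add: hp)
  have "isCont p (h \<tau>)" for \<tau>
    by (rule isCont_inverse_function[where f = h and d = 1 and x = \<tau>]) (simp_all add: ph hcont)
  then have pcont: "isCont p s" for s using hp by metis
  have "(p has_real_derivative inverse (g (p s))) (at s)" for s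
  proof (rule DERIV_inverse_function[where f = h and a = "s - 1" and b = "s + 1"])
    show "g (p s) \<noteq> 0" using pos[of "p s"] by simp
  qed (simp_all add: h hp pcont)
  with smono surj hS S ph pS show ?thesis by blast
qed

text \<open>Along a null geodesic the last term of the Christoffel symbol vanishes, so that the conformal
  factor only changes the parametrization: \<open>\<sigma>' = w / c\<close>.\<close>

lemma null_line_conformal_geodesic:
  assumes c: "torus_smooth c" "\<And>x. c x > 0" and w: "w \<in> null_lattice"
  shows "\<exists>\<sigma> S h. closed_null_geodesic (conformal_minkowski c) \<sigma> S \<and>
    strict_mono h \<and> surj h \<and> (\<forall>\<tau>. h (\<tau> + 1) = h \<tau> + S) \<and>
    (\<lambda>\<tau>. x + \<tau> *\<^sub>R lattice_vec w) = \<sigma> \<circ> h"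
proof -
  define W where "W = lattice_vec w"
  have W: "W \<noteq> 0" "minkowski y W W = 0" for y
    using w null_lattice_iff[of w y] unfolding W_def by blast+
  have csm: "smooth_fun c" and cper: "lattice_periodic c"
    using c(1) by (auto simp: torus_smooth_def periodic_fun_iff)
  note cD = smooth_fun_differentiable[OF csm, unfolded frechet_derivative_works]
  define g where "g \<tau> = c (x + \<tau> *\<^sub>R W)" for \<tau> :: real
  have "continuous_on UNIV g" unfolding g_def
    by (intro continuous_on_compose2[OF smooth_fun_continuous_on[OF csm]] continuous_intros) auto
  moreover have "g (\<tau> + 1) = g \<tau>" for \<tau>
    using lattice_periodicD[OF cper lattice_vec_in_int_lattice, of "x + \<tau> *\<^sub>R W" w]
    by (simp add: g_def W_def algebra_simps)
  moreover have "g \<tau> > 0" for \<tau> using c(2) by (simp add: g_def)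
  ultimately obtain h p S where h: "strict_mono h" "surj h" "\<forall>\<tau>. h (\<tau> + 1) = h \<tau> + S"
    and S: "S > 0" and ph: "\<forall>\<tau>. p (h \<tau>) = \<tau>" and pS: "\<forall>s. p (s + S) = p s + 1"
    and p: "\<forall>s. (p has_real_derivative inverse (g (p s))) (at s)"
    using periodic_positive_reparametrization[of g] by blast
  define \<sigma> where "\<sigma> s = x + p s *\<^sub>R W" for s
  define r where "r s = inverse (c (\<sigma> s))" for s
  have p: "(p has_real_derivative r s) (at s)" for s
    using p by (simp add: r_def \<sigma>_def g_def)
  have \<sigma>': "(\<sigma> has_vector_derivative r s *\<^sub>R W) (at s)" for s
    unfolding \<sigma>_def using p[of s]
    by (auto intro!: derivative_eq_intros)
  define dc where "dc s = frechet_derivative c (at (\<sigma> s))" for s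
  have lin: "linear (dc s)" for s
    unfolding dc_def using cD has_derivative_linear by blast
  have "((\<lambda>s. c (\<sigma> s)) has_derivative (\<lambda>t. dc s (t *\<^sub>R (r s *\<^sub>R W)))) (at s)" for s
    using has_derivative_compose[OF \<sigma>'[unfolded has_vector_derivative_def] cD] by (simp add: dc_def o_def)
  then have "((\<lambda>s. c (\<sigma> s)) has_derivative (\<lambda>t. r s * dc s W * t)) (at s)" for s
    using linear_scale[OF lin] by (simp add: mult_ac)
  then have "((\<lambda>s. c (\<sigma> s)) has_real_derivative r s * dc s W) (at s)" for s
    by (simp add: has_field_derivative_def)
  from DERIV_inverse'[OF this]
  have "(r has_real_derivative - (r s * (r s * dc s W) * r s)) (at s)" for s
    using c(2) unfolding r_def by (simp add: less_imp_neq[symmetric])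
  then have \<sigma>'': "((\<lambda>s. r s *\<^sub>R W) has_vector_derivative - (r s * (r s * dc s W) * r s) *\<^sub>R W) (at s)" for s
    by (auto intro!: derivative_eq_intros)
  \<comment> \<open>\<open>minkowski\<close> ignores its base point, for which 0 stands here, so
    only \<open>c\<close> is differentiated.\<close>
  have chr: "christoffel_first (conformal_minkowski c) (\<sigma> s) (r s *\<^sub>R W) (r s *\<^sub>R W) u
      = r s * r s * dc s W * minkowski 0 W u" for s u
  proof -
    have "frechet_derivative (\<lambda>y. conformal_minkowski c y a b) (at (\<sigma> s)) v = dc s v * minkowski 0 a b"
      for a b v
    proof -
      have "((\<lambda>y. c y * minkowski 0 a b) has_derivative (\<lambda>v. dc s v * minkowski 0 a b)) (at (\<sigma> s))"
        unfolding dc_def using cD by (rule has_derivative_mult_left)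
      from partial_eqI[OF this] show ?thesis
        by (simp add: conformal_minkowski_def minkowski_def)
    qed
    then show ?thesis
      using W(2) linear_scale[OF lin[of s]]
      by (simp add: christoffel_first_def minkowski_scaleR_left minkowski_scaleR_right)
  qed
  have "conformal_minkowski c (\<sigma> s) (- (r s * (r s * dc s W) * r s) *\<^sub>R W) u
      = - (c (\<sigma> s) * r s) * (r s * r s * dc s W * minkowski 0 W u)" for s u
    by (simp add: conformal_minkowski_def minkowski_def algebra_simps)
  \<comment> \<open>This turns the cubic factor in \<open>r\<close> of the acceleration term into
    the quadratic one of the Christoffel term, with opposite sign.\<close>
  moreover have "c (\<sigma> s) * r s = 1" for s using c(2)[of "\<sigma> s"] by (simp add: r_def)
  ultimately have eq: "conformal_minkowski c (\<sigma> s) (- (r s * (r s * dc s W) * r s) *\<^sub>R W) u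
      + christoffel_first (conformal_minkowski c) (\<sigma> s) (r s *\<^sub>R W) (r s *\<^sub>R W) u = 0" for s u
    unfolding chr by simp
  have "geodesic (conformal_minkowski c) \<sigma>"
    unfolding geodesic_def
    by (intro exI[of _ "\<lambda>s. r s *\<^sub>R W"] exI[of _ "\<lambda>s. - (r s * (r s * dc s W) * r s) *\<^sub>R W"]
        allI conjI \<sigma>' \<sigma>'' eq)
  moreover have "vector_derivative \<sigma> (at s) = r s *\<^sub>R W" for s by (rule vector_derivative_at[OF \<sigma>'])
  moreover have "r s *\<^sub>R W \<noteq> 0" for s using W(1) c(2)[of "\<sigma> s"] by (simp add: r_def)
  moreover have "conformal_minkowski c (\<sigma> s) (r s *\<^sub>R W) (r s *\<^sub>R W) = 0" for s
    by (simp add: conformal_minkowski_def minkowski_scaleR_left minkowski_scaleR_right W(2))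
  moreover have "\<sigma> (s + S) = \<sigma> s + lattice_vec w" for s
    using pS[rule_format, of s] by (simp add: \<sigma>_def W_def scaleR_add_left)
  ultimately have "closed_null_geodesic (conformal_minkowski c) \<sigma> S"
    unfolding closed_null_geodesic_def null_geodesic_def using S by (auto simp del: split_paired_Ex)
  moreover have "(\<lambda>\<tau>. x + \<tau> *\<^sub>R lattice_vec w) = \<sigma> \<circ> h"
    by (simp add: fun_eq_iff \<sigma>_def ph W_def)
  ultimately show ?thesis using h by blast
qed


section \<open>The null periodic X-ray transform\<close>

lemma torus_character_eq: "torus_character \<kappa> = character (lattice_vec \<kappa>)"
  by (simp add: fun_eq_iff torus_character_def character_def)

lemma fourier_coeff_eq: "fourier_coeff f \<kappa> = fcoeff f (lattice_vec \<kappa>)"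
  by (simp add: fourier_coeff_def fcoeff_def torus_character_eq)

lemma line_transform_eq: "line_transform w f = line_average (lattice_vec w) f"
  by (simp add: fun_eq_iff line_transform_def line_average_eq)

lemma torus_smooth_iff: "torus_smooth f \<longleftrightarrow> smooth_fun f \<and> lattice_periodic f"
  by (auto simp: torus_smooth_def periodic_fun_iff)

lemma smooth_fun_sqrt_conformal:
  assumes "torus_smooth c" "\<And>x. c x > 0"
  shows "smooth_fun (\<lambda>x. sqrt (c x))" "lattice_periodic (\<lambda>x. sqrt (c x))"
  using assms by (auto simp: torus_smooth_iff smooth_fun_sqrt lattice_periodic_def)

section \<open>Kernels on functions and on distributions\<close>

text \<open>From left to right each flat null line must be realized by a closed null geodesic of
  \<open>c g\<close>. From right to left the flat geodesic comes with
  \<open>has_null_integral\<close>, and only its affine form is used.\<close>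

lemma null_xray_kernel_iff:
  assumes c: "torus_smooth c" "\<And>x. c x > 0" and f: "torus_continuous f"
  shows "(\<forall>\<sigma> S I. closed_null_geodesic (conformal_minkowski c) \<sigma> S \<longrightarrow> has_null_integral c f \<sigma> S I \<longrightarrow> I = 0)
     \<longleftrightarrow> (\<forall>\<kappa>\<in>null_frequencies. fourier_coeff (\<lambda>x. of_real (sqrt (c x)) * f x) \<kappa> = 0)"
proof -
  define F where "F = (\<lambda>x. of_real (sqrt (c x)) * f x)"
  note sq = smooth_fun_sqrt_conformal[OF c]
  have F: "lattice_periodic F" "continuous_on UNIV F"
    using sq(2) f smooth_fun_continuous_on[OF sq(1)]
    by (auto simp: F_def lattice_periodic_def torus_continuous_def periodic_fun_iff intro!: continuous_intros)
  have "(\<forall>\<sigma> S I. closed_null_geodesic (conformal_minkowski c) \<sigma> S \<longrightarrow> has_null_integral c f \<sigma> S I \<longrightarrow> I = 0)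
      \<longleftrightarrow> (\<forall>w\<in>null_lattice. \<forall>x. line_average (lattice_vec w) F x = 0)" (is "?L \<longleftrightarrow> ?R")
  proof
    assume L: ?L
    show ?R
    proof (intro ballI allI)
      fix w x assume w: "w \<in> (null_lattice :: ((int^'a) \<times> int) set)"
      obtain \<sigma> S h where \<sigma>: "closed_null_geodesic (conformal_minkowski c) \<sigma> S"
        "strict_mono h" "surj h" "\<forall>\<tau>. h (\<tau> + 1) = h \<tau> + S"
        "(\<lambda>\<tau>. x + \<tau> *\<^sub>R lattice_vec w) = \<sigma> \<circ> h"
        using null_line_conformal_geodesic[OF c w, of x] by blast
      have "((\<lambda>\<tau>. F (x + \<tau> *\<^sub>R lattice_vec w)) has_integral line_average (lattice_vec w) F x) {0..1}"
        unfolding line_average_eq by (intro integrable_integral line_integrable F(2))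
      then have "has_null_integral c f \<sigma> S (line_average (lattice_vec w) F x)"
        unfolding has_null_integral_def F_def
        using line_closed_null_geodesic[OF w, of x] \<sigma>(2-5) by blast
      then show "line_average (lattice_vec w) F x = 0" using L \<sigma>(1) by blast
    qed
  next
    assume R: ?R
    show ?L
    proof (intro allI impI)
      fix \<sigma> S I assume "has_null_integral c f \<sigma> S I"
      then obtain \<gamma> where "closed_null_geodesic minkowski \<gamma> 1"
        and I: "((\<lambda>\<tau>. F (\<gamma> \<tau>)) has_integral I) {0..1}"
        unfolding has_null_integral_def F_def by blast
      then obtain w where w: "w \<in> null_lattice" "\<forall>\<tau>. \<gamma> \<tau> = \<gamma> 0 + \<tau> *\<^sub>R lattice_vec w"
        using closed_null_geodesic_minkowski by blast
      have "I = integral {0..1} (\<lambda>\<tau>. F (\<gamma> \<tau>))" using I by (simp add: integral_unique)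
      also have "(\<lambda>\<tau>. F (\<gamma> \<tau>)) = (\<lambda>\<tau>. F (\<gamma> 0 + \<tau> *\<^sub>R lattice_vec w))"
        using w(2) by metis
      also have "integral {0..1} \<dots> = 0"
        using R[rule_format, OF w(1), of "\<gamma> 0"] unfolding line_average_eq .
      finally show "I = 0" .
    qed
  qed
  also have "\<dots> \<longleftrightarrow> (\<forall>w\<in>null_lattice. \<forall>k\<in>int_lattice. k \<bullet> lattice_vec w = 0 \<longrightarrow> fcoeff F k = 0)"
    by (intro ball_cong refl line_average_eq_0_iff F lattice_vec_in_int_lattice)
  also have "\<dots> \<longleftrightarrow> (\<forall>\<kappa>\<in>null_frequencies. fourier_coeff F \<kappa> = 0)"
    unfolding int_lattice_eq_range null_frequencies_eq fourier_coeff_eq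
    by (auto simp: inner_commute)
  finally show ?thesis unfolding F_def .
qed

text \<open>Multiplication by the smooth periodic \<open>sqrt c\<close> maps test functions to test
  functions and costs only a constant in the norm estimate, so the abstract criterion applies to the
  product.\<close>

lemma null_xray_kernel_distr_iff:
  assumes c: "torus_smooth c" "\<And>x. c x > 0" and u: "torus_distribution u"
  shows "(\<forall>w\<in>null_lattice. \<forall>\<phi>. torus_smooth \<phi> \<longrightarrow>
            line_transform_distr w (mult_distribution (\<lambda>x. sqrt (c x)) u) \<phi> = 0)
     \<longleftrightarrow> (\<forall>\<kappa>\<in>null_frequencies. fourier_coeff_distr (mult_distribution (\<lambda>x. sqrt (c x)) u) \<kappa> = 0)"
proof -
  define U where "U = mult_distribution (\<lambda>x. sqrt (c x)) u"
  have U: "U \<phi> = u (\<lambda>x. sqrt (c x) *\<^sub>R \<phi> x)" for \<phi>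
    by (simp add: U_def mult_distribution_def scaleR_conv_of_real)
  note sq = smooth_fun_sqrt_conformal[OF c]
  have sm: "torus_smooth (\<lambda>x. sqrt (c x) *\<^sub>R \<phi> x)"
    if "smooth_fun \<phi>" "lattice_periodic \<phi>" for \<phi> :: "(real^'a) \<times> real \<Rightarrow> complex"
    using that sq by (auto simp: torus_smooth_iff smooth_fun_scaleR lattice_periodic_def)
  obtain C m where u_add: "\<And>\<phi> \<psi>. torus_smooth \<phi> \<Longrightarrow> torus_smooth \<psi> \<Longrightarrow> u (\<lambda>x. \<phi> x + \<psi> x) = u \<phi> + u \<psi>"
    and u_scale: "\<And>a \<phi>. torus_smooth \<phi> \<Longrightarrow> u (\<lambda>x. a * \<phi> x) = a * u \<phi>"
    and u_cont: "\<And>\<phi> B. torus_smooth \<phi> \<Longrightarrow> bound_upto m B \<phi> \<Longrightarrow> norm (u \<phi>) \<le> C * B"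
    using u unfolding torus_distribution_def bound_upto_def by blast
  have "bounded (range (iter_partial bs (\<lambda>x. sqrt (c x))))" if "bs \<in> lists Basis" for bs
    using sq that by (intro lattice_periodic_bounded lattice_periodic_iter_partial
        smooth_fun_continuous_on smooth_fun_iter_partial)
  then obtain D where D: "\<And>B \<phi>. smooth_fun \<phi> \<Longrightarrow> bound_upto m B \<phi> \<Longrightarrow>
      bound_upto m (D * B) (\<lambda>x. sqrt (c x) *\<^sub>R (\<phi> x :: complex))"
    using bound_upto_scaleR[OF sq(1), of m] by blast
  have line_iff: "(\<forall>\<phi>. smooth_fun \<phi> \<longrightarrow> lattice_periodic \<phi> \<longrightarrow> U (line_average w \<phi>) = 0) \<longleftrightarrow>
      (\<forall>k\<in>int_lattice. k \<bullet> w = 0 \<longrightarrow> U (character k) = 0)" if "w \<in> int_lattice" for w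
  proof (rule functional_line_average_eq_0_iff[where m = m and C = "C * D"])
    fix \<phi> \<psi> :: "(real^'a) \<times> real \<Rightarrow> complex"
    assume \<phi>: "smooth_fun \<phi>" "lattice_periodic \<phi>"
    show "U (\<lambda>x. a * \<phi> x) = a * U \<phi>" for a
      using u_scale[OF sm[OF \<phi>], of a] by (simp add: U)
    show "norm (U \<phi>) \<le> C * D * B" if "bound_upto m B \<phi>" for B
      using u_cont[OF sm[OF \<phi>] D[OF \<phi>(1) that]] by (simp add: U mult.assoc)
    assume \<psi>: "smooth_fun \<psi>" "lattice_periodic \<psi>"
    show "U (\<lambda>x. \<phi> x + \<psi> x) = U \<phi> + U \<psi>"
      using u_add[OF sm[OF \<phi>] sm[OF \<psi>]] by (simp add: U scaleR_add_right)
  qed (rule that)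
  have "(\<forall>w\<in>null_lattice. \<forall>\<phi>. torus_smooth \<phi> \<longrightarrow> line_transform_distr w U \<phi> = 0)
      \<longleftrightarrow> (\<forall>w\<in>null_lattice. \<forall>k\<in>int_lattice. k \<bullet> lattice_vec w = 0 \<longrightarrow> U (character k) = 0)"
    unfolding torus_smooth_iff line_transform_distr_def line_transform_eq imp_conjL
    by (intro ball_cong refl line_iff lattice_vec_in_int_lattice)
  \<comment> \<open>\<open>fourier_coeff_distr\<close> evaluates at conjugate characters, that is,
    at frequencies \<open>- k\<close>; lattice and hyperplane are symmetric under negation.\<close>
  also have "\<dots> \<longleftrightarrow> (\<forall>w\<in>null_lattice. \<forall>k\<in>int_lattice. k \<bullet> lattice_vec w = 0 \<longrightarrow> U (character (- k)) = 0)"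
  proof -
    have "(\<forall>k\<in>int_lattice. k \<bullet> W = 0 \<longrightarrow> U (character k) = 0) \<longleftrightarrow>
        (\<forall>k\<in>int_lattice. k \<bullet> W = 0 \<longrightarrow> U (character (- k)) = 0)" (is "?L \<longleftrightarrow> ?R") for W
    proof (intro iffI ballI impI)
      fix k :: "(real^'a) \<times> real" assume "?L" "k \<in> int_lattice" "k \<bullet> W = 0"
      then show "U (character (- k)) = 0" using bspec[of _ _ "- k"] int_lattice_uminus[of k] by simp
    next
      fix k :: "(real^'a) \<times> real" assume ?R and k: "k \<in> int_lattice" "k \<bullet> W = 0"
      then show "U (character k) = 0" using bspec[OF \<open>?R\<close> int_lattice_uminus[OF k(1)]] by simp
    qed
    then show ?thesis by simp
  qed
  also have "\<dots> \<longleftrightarrow> (\<forall>\<kappa>\<in>null_frequencies. fourier_coeff_distr U \<kappa> = 0)"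
    unfolding int_lattice_eq_range null_frequencies_eq fourier_coeff_distr_def torus_character_eq cnj_character
    by (auto simp: inner_commute)
  finally show ?thesis unfolding U_def .
qed

theorem theorem9:
  fixes c :: "(real^'n) \<times> real \<Rightarrow> real"
    and K :: "((int^'n) \<times> int) set"
  assumes "torus_smooth c"
    and "\<forall>x. c x > 0"
    and "K = null_frequencies"
  shows
    "null_xray_kernel c =
       {f. torus_continuous f \<and>
           (\<forall>\<kappa>\<in>K. fourier_coeff (\<lambda>x. of_real (sqrt (c x)) * f x) \<kappa> = 0)}
     \<and> null_xray_kernel_distr c =
       {u. torus_distribution u \<and>
           (\<forall>\<kappa>\<in>K. fourier_coeff_distr (mult_distribution (\<lambda>x. sqrt (c x)) u) \<kappa> = 0)}
     \<and> {(k, t). \<bar>real_of_int t\<bar> = norm (rvec k)} \<subseteq> K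
     \<and> K \<subseteq> {(k, t). \<bar>real_of_int t\<bar> \<le> norm (rvec k)}
     \<and> (CARD('n) = 1 \<longrightarrow> K = {(k, t). \<bar>real_of_int t\<bar> = norm (rvec k)})
     \<and> (CARD('n) = 2 \<longrightarrow>
          K = {(k, t). sqrt ((norm (rvec k))\<^sup>2 - \<bar>real_of_int t\<bar>\<^sup>2) \<in> \<nat>})
     \<and> (CARD('n) = 3 \<longrightarrow>
          K = {(k, t). \<exists>a b :: int.
                 (norm (rvec k))\<^sup>2 - \<bar>real_of_int t\<bar>\<^sup>2 = (real_of_int a)\<^sup>2 + (real_of_int b)\<^sup>2})"
proof -
  have c: "\<And>x. c x > 0" using assms(2) by blast
  have "null_xray_kernel c = {f. torus_continuous f \<and>
      (\<forall>\<kappa>\<in>K. fourier_coeff (\<lambda>x. of_real (sqrt (c x)) * f x) \<kappa> = 0)}"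
    unfolding null_xray_kernel_def assms(3) using null_xray_kernel_iff[OF assms(1) c] by blast
  moreover have "null_xray_kernel_distr c = {u. torus_distribution u \<and>
      (\<forall>\<kappa>\<in>K. fourier_coeff_distr (mult_distribution (\<lambda>x. sqrt (c x)) u) \<kappa> = 0)}"
    unfolding null_xray_kernel_distr_def assms(3)
    using null_xray_kernel_distr_iff[OF assms(1) c] by blast
  ultimately show ?thesis
    unfolding assms(3)
    by (intro conjI impI light_cone_subset_null_frequencies null_frequencies_subset_spacelike
        null_frequencies_card_1 null_frequencies_card_2 null_frequencies_card_3)
qed

end
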